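(* Let $K$ be the Sierpinski sickle and let $R_n(p,q)$, $p\ne q$ in $V_0=\{p_1,p_2,p_3\}$, be the trace on $V_0$ of the network on $V_n$ with unit resistance between any two vertices of each cell $V_\omega$, $|\omega|=n$. Then $$R_n(p_1,p_2)\asymp R_n(p_2,p_3)\asymp\Big(\frac{17}2\Big)^n,\qquad\text{and}\qquad R_n(p_3,p_1)\asymp7^n.$$
   Context: $f\asymp g$ means $C^{-1}g\le f\le Cg$ for a constant $C>0$ (independent of $n$). **Sierpinski sickle.** Let $p_1=(0,0)$, $p_2=(1,0)$, $p_3=(\frac12,\frac{\sqrt3}2)$, $V_0=\{p_1,p_2,p_3\}$. For integers $i,j\ge0$ put $q(i,j)=\frac17(i\,p_2+j\,p_3)$; for $i+j\le 6$ the "cell $(i,j)$" is the image of the triangle with vertices $V_0$ under $x\mapsto\frac17x+q(i,j)$, so the images of $p_1,p_2,p_3$ are $q(i,j),q(i+1,j),q(i,j+1)$. The IFS $\{F_i\}_{i=1}^{17}$ consists of the $17$ maps $F_i(x)=\frac17x+a_i$ for the following cells: the five left cells $(0,0),\dots,(0,4)$; the three top cells $(0,5),(1,5),(0,6)$; and nine right cells forming a simple chain from $z_0=q(2,5)$ to $z_9=q(7,0)=p_2$: there are points $z_0,\dots,z_9$ such that $z_{k-1}\neq z_k$ are vertices of the $k$-th right cell, consecutive right cells meet only at $z_k$, non-consecutive right cells are disjoint, the chain meets the left and top cells only in $z_0$, and the pair $\{z_{k-1},z_k\}$ is the image of $\{p_1,p_2\}$ for exactly four, of $\{p_2,p_3\}$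 for exactly three, and of $\{p_3,p_1\}$ for exactly two of the nine right cells. (For example the right cells $(2,4),(3,3),(3,2),(2,2),(2,1),(3,0),(4,0),(5,0),(6,0)$; one such chain is fixed, and the assertions do not depend on which.) $K$ is the nonempty compact set with $K=\bigcup_{i=1}^{17}F_i(K)$. Put $V_n=\bigcup_iF_i(V_{n-1})$; for a word $\omega=\omega_1\cdots\omega_n$, $|\omega|=n$, $F_\omega=F_{\omega_1}\circ\cdots\circ F_{\omega_n}$, $V_\omega=F_\omega(V_0)$. **Trace.** With $E_n[u]=\sum_{|\omega|=n}\sum_{\{x,y\}\subset V_\omega}|u(x)-u(y)|^2$ (unordered pairs) for $u:V_n\to\mathbb R$, the trace $R_n(p,q)$ is defined by: for all $u:V_0\to\mathbb R$, $\min\{E_n[v]: v:V_n\to\mathbb R,\ v|_{V_0}=u\}=\sum_{\{p,q\}\subset V_0}\frac1{R_n(p,q)}|u(p)-u(q)|^2$. *)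

theory Defs
  imports "HOL-Analysis.Analysis"
begin

type_synonym point = "real \<times> real"

definition p1 :: point where "p1 = (0, 0)"
definition p2 :: point where "p2 = (1, 0)"
definition p3 :: point where "p3 = (1/2, sqrt 3 / 2)"

definition V0 :: "point set" where "V0 = {p1, p2, p3}"

definition lattice_pt :: "nat \<Rightarrow> nat \<Rightarrow> point" where
  "lattice_pt i j = (1/7) *\<^sub>R (real i *\<^sub>R p2 + real j *\<^sub>R p3)"

text \<open>The maps of the iterated function system are indexed by the positions of their cells
  rather than by 1, ..., 17. Distinct positions give distinct maps.\<close>

fun cell_map :: "nat \<times> nat \<Rightarrow> point \<Rightarrow> point" where
  "cell_map (i, j) x = (1/7) *\<^sub>R x + lattice_pt i j"

definition cell :: "nat \<times> nat \<Rightarrow> point set" where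
  "cell c = cell_map c ` (convex hull V0)"

definition left_cells :: "(nat \<times> nat) set" where
  "left_cells = {(0,0), (0,1), (0,2), (0,3), (0,4)}"

definition top_cells :: "(nat \<times> nat) set" where
  "top_cells = {(0,5), (1,5), (0,6)}"

text \<open>\<open>c k\<close> for \<open>1 \<le> k \<le> 9\<close> is the position of the \<open>k\<close>-th right cell, and \<open>z 0, ..., z 9\<close> are the
  junction points of the chain; other values of \<open>c\<close> and \<open>z\<close> are irrelevant. An admissible choice
  is (2,4), (3,3), (3,2), (2,2), (2,1), (3,0), (4,0), (5,0), (6,0).\<close>

definition right_chain :: "(nat \<Rightarrow> nat \<times> nat) \<Rightarrow> (nat \<Rightarrow> point) \<Rightarrow> bool" where
  "right_chain c z \<longleftrightarrow>
     (\<forall>k\<in>{1..9}. fst (c k) + snd (c k) \<le> 6) \<and>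
     z 0 = lattice_pt 2 5 \<and> z 9 = lattice_pt 7 0 \<and>
     (\<forall>k\<in>{1..9}. z (k - 1) \<noteq> z k \<and> {z (k - 1), z k} \<subseteq> cell_map (c k) ` V0) \<and>
     (\<forall>k\<in>{1..8}. cell (c k) \<inter> cell (c (k + 1)) = {z k}) \<and>
     (\<forall>k\<in>{1..9}. \<forall>l\<in>{1..9}. k + 1 < l \<longrightarrow> cell (c k) \<inter> cell (c l) = {}) \<and>
     (\<Union>k\<in>{1..9}. cell (c k)) \<inter> (\<Union>d\<in>left_cells \<union> top_cells. cell d) = {z 0} \<and>
     card {k\<in>{1..9}. {z (k - 1), z k} = cell_map (c k) ` {p1, p2}} = 4 \<and>
     card {k\<in>{1..9}. {z (k - 1), z k} = cell_map (c k) ` {p2, p3}} = 3 \<and>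
     card {k\<in>{1..9}. {z (k - 1), z k} = cell_map (c k) ` {p3, p1}} = 2"

text \<open>For an admissible chain this set has 17 elements.\<close>

definition sickle_cells :: "(nat \<Rightarrow> nat \<times> nat) \<Rightarrow> (nat \<times> nat) set" where
  "sickle_cells c = left_cells \<union> top_cells \<union> c ` {1..9}"

definition self_similar_set :: "(nat \<times> nat) set \<Rightarrow> point set \<Rightarrow> bool" where
  "self_similar_set C K \<longleftrightarrow> K \<noteq> {} \<and> compact K \<and> K = (\<Union>d\<in>C. cell_map d ` K)"

primrec V :: "(nat \<times> nat) set \<Rightarrow> nat \<Rightarrow> point set" where
  "V C 0 = V0"
| "V C (Suc n) = (\<Union>d\<in>C. cell_map d ` V C n)"

definition words :: "(nat \<times> nat) set \<Rightarrow> nat \<Rightarrow> (nat \<times> nat) list set" where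
  "words C n = {w. set w \<subseteq> C \<and> length w = n}"

definition V_word :: "(nat \<times> nat) list \<Rightarrow> point set" where
  "V_word w = foldr cell_map w ` V0"

text \<open>Sum over unordered pairs of distinct points, for symmetric \<open>f\<close>: each pair is met twice in the
  double sum.\<close>

definition pair_sum :: "point set \<Rightarrow> (point \<Rightarrow> point \<Rightarrow> real) \<Rightarrow> real" where
  "pair_sum A f = (\<Sum>x\<in>A. \<Sum>y\<in>A - {x}. f x y) / 2"

definition energy :: "(nat \<times> nat) set \<Rightarrow> nat \<Rightarrow> (point \<Rightarrow> real) \<Rightarrow> real" where
  "energy C n u = (\<Sum>w\<in>words C n. pair_sum (V_word w) (\<lambda>x y. \<bar>u x - u y\<bar>\<^sup>2))"

definition is_minimum :: "real \<Rightarrow> real set \<Rightarrow> bool" where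
  "is_minimum m A \<longleftrightarrow> m \<in> A \<and> (\<forall>a\<in>A. m \<le> a)"

definition is_trace :: "(nat \<times> nat) set \<Rightarrow> nat \<Rightarrow> (point \<Rightarrow> point \<Rightarrow> real) \<Rightarrow> bool" where
  "is_trace C n R \<longleftrightarrow>
     (\<forall>p\<in>V0. \<forall>q\<in>V0. p \<noteq> q \<longrightarrow> 0 < R p q \<and> R p q = R q p) \<and>
     (\<forall>u \<in> V0 \<rightarrow>\<^sub>E UNIV.
        is_minimum (pair_sum V0 (\<lambda>p q. 1 / R p q * \<bar>u p - u q\<bar>\<^sup>2))
          {energy C n v | v. v \<in> V C n \<rightarrow>\<^sub>E UNIV \<and> restrict v V0 = u})"

text \<open>The defining identity constrains \<open>R p q\<close> only for distinct \<open>p\<close>, \<open>q\<close> in \<open>V0\<close>, so the definite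
  description is taken entrywise.\<close>

definition trace_res :: "(nat \<times> nat) set \<Rightarrow> nat \<Rightarrow> point \<Rightarrow> point \<Rightarrow> real" where
  "trace_res C n p q = (THE r. \<exists>R. is_trace C n R \<and> r = R p q)"

definition comparable :: "(nat \<Rightarrow> real) \<Rightarrow> (nat \<Rightarrow> real) \<Rightarrow> bool" (infix "\<asymp>" 50) where
  "f \<asymp> g \<longleftrightarrow> (\<exists>C>0. \<forall>n. inverse C * g n \<le> f n \<and> f n \<le> C * g n)"

end

theory Submission
  imports Defs
begin

text \<open>
  Seen from its three corners, the network of level \<open>n\<close> is a star: three resistors \<open>r p1\<close>, \<open>r p2\<close>,
  \<open>r p3\<close> meeting in a new centre. The network of level \<open>n + 1\<close> consists of 17 copies of the network
  of level \<open>n\<close>, joined only at corners (\<open>cell_inter_corner\<close>), so it is equivalent to 17 copies of the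
  star, and these reduce to a single star again. The left cells are five resistors \<open>r p1 + r p3\<close> in
  series, the right cells are nine resistors in series, four, three and two of each kind, and the
  three top cells surround a triangle, which the triangle-star transformation turns into a star.
  This gives the recursion \<open>next_star\<close>.

  The reduction is proved by current flows (\<open>equivalent_star_Suc\<close>). A flow that satisfies Kirchhoff's
  node law bounds the energy of all admissible potentials from below (\<open>star_energy_dual\<close>), and a
  potential that obeys Ohm's law for the same flow attains the bound (\<open>star_energy_flow\<close>). Hence it
  suffices to write down the flow and the potential (\<open>sickle_network\<close>); the minimisers inside the
  cells are then glued along the common corners (\<open>glue_cells\<close>).

  Let \<open>x = r p3 + r p1\<close> be the resistance of the path from \<open>p3\<close> to \<open>p1\<close>. The recursion says that \<open>x\<close>
  is replaced by \<open>7 x - x\<^sup>2 / (2 (r p1 + r p2 + r p3))\<close>, and \<open>r p2\<close> by \<open>17/2 r p2\<close> plus a term of order \<open>x\<close>.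
  As \<open>7 < 17/2\<close>, the ratio \<open>x / r p2\<close> decays geometrically, both corrections are summable, and so
  \<open>x\<close> is comparable to \<open>7\<^sup>n\<close> and \<open>r p2\<close> to \<open>(17/2)\<^sup>n\<close>, while \<open>r p1\<close> and \<open>r p3\<close> both stay comparable to
  \<open>x\<close>. Turning the star back into a triangle (\<open>triangle_res_bounds\<close>), the two edges at \<open>p2\<close> have
  resistance of order \<open>r p2\<close> and the edge from \<open>p3\<close> to \<open>p1\<close> has resistance of order \<open>x\<close>.
\<close>

section \<open>The energy of a star of three resistors\<close>

lemma V0_distinct [simp]:
  "p1 \<noteq> p2" "p2 \<noteq> p3" "p3 \<noteq> p1" "p2 \<noteq> p1" "p3 \<noteq> p2" "p1 \<noteq> p3"
  by (auto simp: p1_def p2_def p3_def)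

lemma V0_mem [simp]: "p1 \<in> V0" "p2 \<in> V0" "p3 \<in> V0"
  by (auto simp: V0_def)

lemma finite_V0 [simp]: "finite V0"
  by (simp add: V0_def)

lemma sum_V0: "(\<Sum>p\<in>V0. f p) = f p1 + f p2 + f p3"
  by (simp add: V0_def add.assoc)

lemma pair_sum_V0:
  assumes "\<And>x y. x \<in> V0 \<Longrightarrow> y \<in> V0 \<Longrightarrow> x \<noteq> y \<Longrightarrow> f x y = f y x"
  shows "pair_sum V0 f = f p1 p2 + f p2 p3 + f p3 p1"
proof -
  have "V0 - {p1} = {p2, p3}" "V0 - {p2} = {p1, p3}" "V0 - {p3} = {p1, p2}"
    by (auto simp: V0_def)
  then have "pair_sum V0 f = (f p1 p2 + f p1 p3 + (f p2 p1 + f p2 p3) + (f p3 p1 + f p3 p2)) / 2"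
    by (simp add: pair_sum_def sum_V0)
  then show ?thesis
    using assms[of p1 p2] assms[of p2 p3] assms[of p3 p1] by simp
qed

text \<open>The least energy \<open>(u p1 - m)\<^sup>2 / r p1 + (u p2 - m)\<^sup>2 / r p2 + (u p3 - m)\<^sup>2 / r p3\<close> over all potentials \<open>m\<close>
  of the centre, written in the form of the equivalent triangle of resistors.\<close>

definition star_energy :: "(point \<Rightarrow> real) \<Rightarrow> (point \<Rightarrow> real) \<Rightarrow> real" where
  "star_energy r u =
     (r p3 * (u p1 - u p2)\<^sup>2 + r p1 * (u p2 - u p3)\<^sup>2 + r p2 * (u p3 - u p1)\<^sup>2) /
     (r p1 * r p2 + r p2 * r p3 + r p3 * r p1)"

text \<open>A potential that drives the balanced flow \<open>i\<close> into the star, with the centre at potential \<open>m\<close>,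
  has the dissipation of that flow as its energy.\<close>

lemma star_energy_flow:
  assumes r: "\<And>p. p \<in> V0 \<Longrightarrow> r p > 0"
    and i: "sum i V0 = 0"
    and u: "\<And>p. p \<in> V0 \<Longrightarrow> u p = m + r p * i p"
  shows "star_energy r u = (\<Sum>p\<in>V0. r p * (i p)\<^sup>2)"
proof -
  let ?P = "r p1 * r p2 + r p2 * r p3 + r p3 * r p1"
  have "r p1 > 0" "r p2 > 0" "r p3 > 0" by (simp_all add: r)
  then have P: "?P > 0" by (simp add: add_pos_pos)
  have i3: "i p3 = - i p1 - i p2" using i by (simp add: sum_V0)
  have "r p3 * (u p1 - u p2)\<^sup>2 + r p1 * (u p2 - u p3)\<^sup>2 + r p2 * (u p3 - u p1)\<^sup>2
      = ?P * (r p1 * (i p1)\<^sup>2 + r p2 * (i p2)\<^sup>2 + r p3 * (i p3)\<^sup>2)"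
    by (simp add: u i3) algebra
  then show ?thesis using P by (simp add: star_energy_def sum_V0)
qed

text \<open>The centre takes the average of the corner potentials, weighted by the conductances.\<close>

lemma star_flow_exists:
  fixes r u :: "point \<Rightarrow> real"
  assumes r: "\<And>p. p \<in> V0 \<Longrightarrow> r p > 0"
  shows "\<exists>m i. sum i V0 = 0 \<and> (\<forall>p\<in>V0. u p = m + r p * i p)"
proof -
  define G where "G = (\<Sum>p\<in>V0. 1 / r p)"
  define m where "m = (\<Sum>p\<in>V0. u p / r p) / G"
  define i where "i p = (u p - m) / r p" for p
  have "G > 0" unfolding G_def by (intro sum_pos) (auto simp: r V0_def)
  have "sum i V0 = (\<Sum>p\<in>V0. u p / r p) - m * G"
    by (simp add: i_def G_def diff_divide_distrib sum_subtractf sum_distrib_left)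
  also have "\<dots> = 0" using \<open>G > 0\<close> by (simp add: m_def)
  finally have "sum i V0 = 0" .
  moreover have "u p = m + r p * i p" if "p \<in> V0" for p
    using r[OF that] by (simp add: i_def)
  ultimately show ?thesis by blast
qed

text \<open>Thomson's principle: a test flow \<open>i\<close> gives a lower bound for the energy, and the defect is the
  dissipation of the difference of \<open>i\<close> and the true flow.\<close>

lemma star_energy_dual:
  assumes r: "\<And>p. p \<in> V0 \<Longrightarrow> r p > 0" and i: "sum i V0 = 0"
  shows "2 * (\<Sum>p\<in>V0. i p * u p) - (\<Sum>p\<in>V0. r p * (i p)\<^sup>2) \<le> star_energy r u"
proof -
  obtain m j where j: "sum j V0 = 0" "\<And>p. p \<in> V0 \<Longrightarrow> u p = m + r p * j p"
    using star_flow_exists[of r u, OF r] by blast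
  have "(\<Sum>p\<in>V0. i p * u p) = (\<Sum>p\<in>V0. m * i p + r p * i p * j p)"
    by (intro sum.cong refl) (simp add: j(2) algebra_simps)
  also have "\<dots> = (\<Sum>p\<in>V0. r p * i p * j p)"
    using i by (simp add: sum.distrib flip: sum_distrib_left)
  finally have iu: "(\<Sum>p\<in>V0. i p * u p) = (\<Sum>p\<in>V0. r p * i p * j p)" .
  have "0 \<le> (\<Sum>p\<in>V0. r p * (i p - j p)\<^sup>2)"
    by (intro sum_nonneg) (simp add: r less_imp_le)
  also have "\<dots> = (\<Sum>p\<in>V0. r p * (j p)\<^sup>2) + (\<Sum>p\<in>V0. r p * (i p)\<^sup>2)
      - 2 * (\<Sum>p\<in>V0. r p * i p * j p)"
    by (simp add: sum_V0 power2_diff) (simp add: algebra_simps)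
  finally show ?thesis
    using star_energy_flow[OF r j] iu by simp
qed

section \<open>Geometry of the cells\<close>

lemma cell_map_eq: "cell_map d x = (1/7) *\<^sub>R x + lattice_pt (fst d) (snd d)"
  by (cases d) simp

declare cell_map.simps [simp del]

lemma cell_map_inj: "inj (cell_map d)"
  by (auto simp: inj_on_def cell_map_eq)

lemma cell_map_eq_iff [simp]: "cell_map d x = cell_map d y \<longleftrightarrow> x = y"
  using cell_map_inj by (rule inj_eq)

lemma cell_map_corner [simp]:
  "cell_map (i, j) p1 = lattice_pt i j"
  "cell_map (i, j) p2 = lattice_pt (Suc i) j"
  "cell_map (i, j) p3 = lattice_pt i (Suc j)"
  by (simp_all add: cell_map_eq lattice_pt_def p1_def p2_def p3_def field_simps)

lemma lattice_pt_V0: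
  "lattice_pt 0 0 = p1" "lattice_pt 7 0 = p2" "lattice_pt 0 7 = p3"
  by (simp_all add: lattice_pt_def p1_def p2_def p3_def)

lemma oblique_coords_unique:
  assumes "a *\<^sub>R p2 + b *\<^sub>R p3 = a' *\<^sub>R p2 + b' *\<^sub>R p3"
  shows "a = a'" "b = b'"
  using assms by (auto simp: p2_def p3_def)

lemma lattice_pt_inj:
  assumes "lattice_pt i j = lattice_pt k l"
  shows "i = k" "j = l"
  using oblique_coords_unique[of "real i" "real j" "real k" "real l"] assms
  by (auto simp: lattice_pt_def)

lemma hull_coords:
  assumes "x \<in> convex hull V0"
  obtains a b where "a \<ge> 0" "b \<ge> 0" "a + b \<le> 1" "x = a *\<^sub>R p2 + b *\<^sub>R p3"
proof -
  obtain s a b where "s \<ge> 0" "a \<ge> 0" "b \<ge> 0" "s + a + b = (1::real)"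
      "x = s *\<^sub>R p1 + a *\<^sub>R p2 + b *\<^sub>R p3"
    using assms unfolding V0_def convex_hull_3 by blast
  then show thesis by (intro that[of a b]) (auto simp: p1_def zero_prod_def[symmetric])
qed

lemma V0_subset_hull: "V0 \<subseteq> convex hull V0"
  by (rule hull_subset)

lemma corner_in_cell: "p \<in> V0 \<Longrightarrow> cell_map d p \<in> cell d"
  using V0_subset_hull by (auto simp: cell_def)

text \<open>In coordinates along \<open>p2\<close> and \<open>p3\<close>, scaled by 7, the cell \<open>(i, j)\<close> is the triangle \<open>a \<ge> i\<close>, \<open>b \<ge> j\<close>,
  \<open>a + b \<le> i + j + 1\<close>. If two such triangles have different left sides, or else different lower sides,
  then the inequalities leave only a lattice point in common.\<close>

lemma cell_inter_corner:
  assumes x: "x \<in> convex hull V0" and y: "y \<in> convex hull V0"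
    and eq: "cell_map d x = cell_map e y" and de: "d \<noteq> e"
  shows "x \<in> V0"
proof -
  obtain i j k l where d: "d = (i, j)" and e: "e = (k, l)" by fastforce
  obtain a b where ab: "a \<ge> 0" "b \<ge> 0" "a + b \<le> 1" "x = a *\<^sub>R p2 + b *\<^sub>R p3"
    using hull_coords[OF x] by blast
  obtain a' b' where ab': "a' \<ge> 0" "b' \<ge> 0" "a' + b' \<le> 1" "y = a' *\<^sub>R p2 + b' *\<^sub>R p3"
    using hull_coords[OF y] by blast
  have "(a + i) *\<^sub>R p2 + (b + j) *\<^sub>R p3 = 7 *\<^sub>R cell_map d x"
    by (simp add: d ab cell_map_eq lattice_pt_def algebra_simps)
  also have "\<dots> = (a' + k) *\<^sub>R p2 + (b' + l) *\<^sub>R p3"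
    unfolding eq
    by (simp add: e ab' cell_map_eq lattice_pt_def algebra_simps)
  finally have 1: "a + i = a' + k" and 2: "b + j = b' + l"
    by (rule oblique_coords_unique)+
  have "(a = 0 \<and> b = 0) \<or> (a = 1 \<and> b = 0) \<or> (a = 0 \<and> b = 1)"
  proof (rule ccontr)
    assume n: "\<not> ?thesis"
    consider "i < k" | "k < i" | "i = k" "j < l" | "i = k" "l < j"
      using de d e by fastforce
    \<comment> \<open>The two pairs of cases are not symmetric, since the conclusion is about the point in cell \<open>d\<close>.\<close>
    then show False
    proof cases
      case 1
      then have "real k \<ge> real i + 1" by simp
      then show False using \<open>a + i = a' + k\<close> ab ab' n by argo
    next
      case 2
      then have "real i \<ge> real k + 1" by simp
      then have a: "a = 0" "a' = 1" "b' = 0" using \<open>a + i = a' + k\<close> ab ab' by argo+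
      then have b: "b + real j = real l" using \<open>b + j = b' + l\<close> by simp
      have "b < 1" "b > 0" using n a ab by force+
      then have "real j < real l" "real l < real j + 1" using b by linarith+
      then have "j < l" "l < j + 1" by linarith+
      then show False by simp
    next
      case 3
      then have "real l \<ge> real j + 1" by simp
      then show False using \<open>b + j = b' + l\<close> ab ab' n by argo
    next
      case 4
      then have "real j \<ge> real l + 1" by simp
      then have b: "b = 0" "b' = 1" "a' = 0" using \<open>b + j = b' + l\<close> ab ab' by argo+
      then have "a = 0" using \<open>a + i = a' + k\<close> 4 by simp
      then show False using n b by simp
    qed
  qed
  moreover have "p1 = 0" by (simp add: p1_def zero_prod_def)
  ultimately show ?thesis using ab(4) by (auto simp: V0_def)
qed

lemma cell_subset_hull:
  assumes "fst d + snd d \<le> 6" "x \<in> convex hull V0"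
  shows "cell_map d x \<in> convex hull V0"
proof -
  obtain a b where ab: "a \<ge> 0" "b \<ge> 0" "a + b \<le> 1" "x = a *\<^sub>R p2 + b *\<^sub>R p3"
    using hull_coords[OF assms(2)] by blast
  let ?a = "(a + fst d) / 7" and ?b = "(b + snd d) / 7"
  have "cell_map d x = (1 - ?a - ?b) *\<^sub>R p1 + ?a *\<^sub>R p2 + ?b *\<^sub>R p3"
    by (simp add: cell_map_eq ab lattice_pt_def p1_def p2_def p3_def field_simps)
  moreover have "real (fst d) + real (snd d) \<le> 6" using assms(1) by linarith
  then have "0 \<le> 1 - ?a - ?b" "0 \<le> ?a" "0 \<le> ?b" "1 - ?a - ?b + ?a + ?b = 1"
    using ab by (auto simp: field_simps)
  ultimately show ?thesis
    unfolding V0_def convex_hull_3 by blast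
qed

section \<open>Self-similarity of the energy\<close>

lemma V_subset_hull:
  assumes "\<forall>d\<in>C. fst d + snd d \<le> 6"
  shows "V C n \<subseteq> convex hull V0"
proof (induction n)
  case (Suc n)
  then show ?case using assms cell_subset_hull by fastforce
qed (simp add: V0_subset_hull)

lemma V0_subset_V:
  assumes "V0 \<subseteq> (\<Union>d\<in>C. cell_map d ` V0)"
  shows "V0 \<subseteq> V C n"
proof (induction n)
  case (Suc n)
  then show ?case using assms by fastforce
qed simp

lemma words_Suc: "words C (Suc n) = (\<lambda>(d, w). d # w) ` (C \<times> words C n)"
proof (rule set_eqI)
  fix w show "w \<in> words C (Suc n) \<longleftrightarrow> w \<in> (\<lambda>(d, w). d # w) ` (C \<times> words C n)"
    by (cases w) (auto simp: words_def image_iff)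
qed

lemma pair_sum_image:
  assumes "inj f"
  shows "pair_sum (f ` A) g = pair_sum A (\<lambda>x y. g (f x) (f y))"
proof -
  have "f ` A - {f x} = f ` (A - {x})" for x
    using assms by (simp add: image_set_diff)
  then show ?thesis
    using assms by (simp add: pair_sum_def sum.reindex inj_on_subset)
qed

lemma energy_0: "energy C 0 u = (u p1 - u p2)\<^sup>2 + (u p2 - u p3)\<^sup>2 + (u p3 - u p1)\<^sup>2"
proof -
  have "words C 0 = {[]}" by (auto simp: words_def)
  then show ?thesis
    by (simp add: energy_def V_word_def pair_sum_V0 power2_commute)
qed

lemma energy_Suc:
  assumes "finite C"
  shows "energy C (Suc n) u = (\<Sum>d\<in>C. energy C n (u \<circ> cell_map d))"
proof -
  have "inj_on (\<lambda>(d, w). d # w) (C \<times> words C n)" by (auto simp: inj_on_def)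
  moreover have "V_word (d # w) = cell_map d ` V_word w" for d w
    by (simp add: V_word_def image_comp)
  ultimately show ?thesis
    by (simp add: energy_def words_Suc sum.reindex sum.cartesian_product case_prod_unfold
        pair_sum_image cell_map_inj)
qed

lemma V_word_subset: "w \<in> words C n \<Longrightarrow> V_word w \<subseteq> V C n"
proof (induction n arbitrary: w)
  case 0
  then show ?case by (simp add: words_def V_word_def)
next
  case (Suc n)
  then obtain d w' where w: "w = d # w'" "d \<in> C" "w' \<in> words C n"
    by (auto simp: words_Suc)
  then have "V_word w = cell_map d ` V_word w'" by (simp add: V_word_def image_comp)
  then show ?case using w Suc.IH[of w'] by auto
qed

lemma energy_cong:
  assumes "\<And>x. x \<in> V C n \<Longrightarrow> u x = v x"
  shows "energy C n u = energy C n v"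
proof -
  have "pair_sum (V_word w) (\<lambda>x y. \<bar>u x - u y\<bar>\<^sup>2) = pair_sum (V_word w) (\<lambda>x y. \<bar>v x - v y\<bar>\<^sup>2)"
    if "w \<in> words C n" for w
  proof -
    have "u x = v x" if "x \<in> V_word w" for x
      using assms V_word_subset[OF \<open>w \<in> words C n\<close>] that by blast
    then show ?thesis by (simp add: pair_sum_def)
  qed
  then show ?thesis by (simp add: energy_def)
qed

lemma is_minimum_image_iff:
  "is_minimum m {F v | v. P v} \<longleftrightarrow> (\<exists>v. P v \<and> F v = m) \<and> (\<forall>v. P v \<longrightarrow> m \<le> F v)"
  by (auto simp: is_minimum_def)

text \<open>A level \<open>n\<close> network and a star that respond alike to every choice of corner potentials. Here the
  potentials are defined on the whole plane, which spares domain conditions in the gluing.\<close>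

definition equivalent_star :: "(nat \<times> nat) set \<Rightarrow> nat \<Rightarrow> (point \<Rightarrow> real) \<Rightarrow> bool" where
  "equivalent_star C n r \<longleftrightarrow>
     (\<forall>p\<in>V0. r p > 0) \<and>
     (\<forall>u. is_minimum (star_energy r u) {energy C n v | v. \<forall>p\<in>V0. v p = u p})"

lemma equivalent_star_0: "equivalent_star C 0 (\<lambda>_. 1/3)"
proof -
  have "energy C 0 v = star_energy (\<lambda>_. 1/3) u" if "\<forall>p\<in>V0. v p = u p" for u v
    using that by (simp add: energy_0 star_energy_def field_simps)
  note E = this
  have "is_minimum (star_energy (\<lambda>_. 1/3) u) {energy C 0 v | v. \<forall>p\<in>V0. v p = u p}" for u
    unfolding is_minimum_image_iff
    using E[of u u] E[of _ u] by auto
  then show ?thesis by (simp add: equivalent_star_def)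
qed

text \<open>A point of two cells is a corner of both, where both functions take the value of \<open>g\<close>; so it does
  not matter from which cell the value of the glued function is read off.\<close>

lemma glue_cells:
  assumes "\<And>d p. d \<in> C \<Longrightarrow> p \<in> V0 \<Longrightarrow> f d p = g (cell_map d p)"
  obtains v where "\<And>d x. d \<in> C \<Longrightarrow> x \<in> convex hull V0 \<Longrightarrow> v (cell_map d x) = f d x"
proof -
  define \<phi> where "\<phi> y = (SOME e. e \<in> C \<and> y \<in> cell_map e ` (convex hull V0))" for y
  define v where "v y = f (\<phi> y) (inv (cell_map (\<phi> y)) y)" for y
  have "v (cell_map d x) = f d x" if d: "d \<in> C" and x: "x \<in> convex hull V0" for d x
  proof -
    let ?e = "\<phi> (cell_map d x)"
    have "?e \<in> C \<and> cell_map d x \<in> cell_map ?e ` (convex hull V0)"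
      unfolding \<phi>_def by (rule someI[of _ d]) (use d x in auto)
    then obtain y where e: "?e \<in> C" and y: "y \<in> convex hull V0" "cell_map d x = cell_map ?e y"
      by auto
    have "inv (cell_map ?e) (cell_map d x) = y"
      using y(2) cell_map_inj by (metis inv_f_f)
    then have "v (cell_map d x) = f ?e y" by (simp add: v_def)
    also have "\<dots> = f d x"
    proof (cases "d = ?e")
      case True
      then show ?thesis using y(2) by (metis cell_map_eq_iff)
    next
      case False
      then have "x \<in> V0" "y \<in> V0"
        using cell_inter_corner x y by metis+
      then show ?thesis using assms d e y(2) by metis
    qed
    finally show ?thesis .
  qed
  then show thesis by (rule that)
qed

text \<open>In the assumption \<open>network\<close>, \<open>I\<close> is the current fed into the corners, \<open>i d\<close> the current that enters
  the cell \<open>d\<close> through its corners, \<open>m d\<close> the potential of the centre of the star that replaces this cell,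
  and \<open>g\<close> the potential of the cell corners. The four conditions are: no current is lost in a cell;
  Ohm's law in each cell; Kirchhoff's node law at the cell corners, in the weak form tested against \<open>w\<close>;
  Ohm's law in the large star. The node law enters twice. Tested against any admissible potential,
  it turns the sum of the dual bounds of the cells into a lower bound that depends on the corner values
  alone. Tested against \<open>g\<close>, it shows that the dissipation of the cells is that of the large star.\<close>

lemma equivalent_star_Suc:
  assumes C: "finite C" "\<forall>d\<in>C. fst d + snd d \<le> 6" "V0 \<subseteq> (\<Union>d\<in>C. cell_map d ` V0)"
    and r: "equivalent_star C n r" and r': "\<And>p. p \<in> V0 \<Longrightarrow> r' p > 0"
    and network: "\<And>I. sum I V0 = 0 \<Longrightarrow> \<exists>i m g.
      (\<forall>d\<in>C. sum (i d) V0 = 0) \<and>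
      (\<forall>d\<in>C. \<forall>p\<in>V0. g (cell_map d p) = m d + r p * i d p) \<and>
      (\<forall>w. (\<Sum>d\<in>C. \<Sum>p\<in>V0. i d p * w (cell_map d p)) = (\<Sum>p\<in>V0. I p * w p)) \<and>
      (\<forall>p\<in>V0. g p = r' p * I p)"
  shows "equivalent_star C (Suc n) r'"
proof -
  have r_pos: "\<And>p. p \<in> V0 \<Longrightarrow> r p > 0"
    and r_min: "\<And>u. is_minimum (star_energy r u) {energy C n v | v. \<forall>p\<in>V0. v p = u p}"
    using r by (auto simp: equivalent_star_def)
  have "is_minimum (star_energy r' u) {energy C (Suc n) v | v. \<forall>p\<in>V0. v p = u p}" for u
  proof -
    obtain M I where I: "sum I V0 = 0" and u: "\<And>p. p \<in> V0 \<Longrightarrow> u p = M + r' p * I p"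
      using star_flow_exists[of r' u, OF r'] by blast
    obtain i m g0 where net: "\<forall>d\<in>C. sum (i d) V0 = 0"
      "\<forall>d\<in>C. \<forall>p\<in>V0. g0 (cell_map d p) = m d + r p * i d p"
      "\<forall>w. (\<Sum>d\<in>C. \<Sum>p\<in>V0. i d p * w (cell_map d p)) = (\<Sum>p\<in>V0. I p * w p)"
      "\<forall>p\<in>V0. g0 p = r' p * I p"
      using network[OF I] by (elim exE conjE) (rule that; assumption)
    have i: "\<And>d. d \<in> C \<Longrightarrow> sum (i d) V0 = 0"
      and g0: "\<And>d p. d \<in> C \<Longrightarrow> p \<in> V0 \<Longrightarrow> g0 (cell_map d p) = m d + r p * i d p"
      and kirchhoff: "\<And>w. (\<Sum>d\<in>C. \<Sum>p\<in>V0. i d p * w (cell_map d p)) = (\<Sum>p\<in>V0. I p * w p)"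
      and g0': "\<And>p. p \<in> V0 \<Longrightarrow> g0 p = r' p * I p"
      using net by blast+
    define g where "g x = M + g0 x" for x
    have g: "g (cell_map d p) = (M + m d) + r p * i d p" if "d \<in> C" "p \<in> V0" for d p
      using g0[OF that] by (simp add: g_def)
    have gu: "g p = u p" if "p \<in> V0" for p
      using g0'[OF that] u[OF that] by (simp add: g_def)
    \<comment> \<open>\<open>D\<close> is the total dissipation of the flow and turns out to be the minimal energy.\<close>
    define D where "D = (\<Sum>d\<in>C. \<Sum>p\<in>V0. r p * (i d p)\<^sup>2)"
    have cell_D: "star_energy r (g \<circ> cell_map d) = (\<Sum>p\<in>V0. r p * (i d p)\<^sup>2)" if "d \<in> C" for d
      by (rule star_energy_flow[where m = "M + m d"]) (simp_all add: r_pos i g that)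
    have cell_D': "(\<Sum>p\<in>V0. r p * (i d p)\<^sup>2) = (\<Sum>p\<in>V0. i d p * g (cell_map d p))"
      if "d \<in> C" for d
    proof -
      have "(\<Sum>p\<in>V0. i d p * g (cell_map d p)) = (M + m d) * sum (i d) V0 + (\<Sum>p\<in>V0. r p * (i d p)\<^sup>2)"
        unfolding sum_distrib_left sum.distrib[symmetric]
        by (intro sum.cong refl) (simp add: g that power2_eq_square algebra_simps)
      then show ?thesis using i[OF that] by simp
    qed
    have "D = (\<Sum>p\<in>V0. I p * g p)"
      unfolding D_def kirchhoff[symmetric] by (rule sum.cong) (simp_all add: cell_D')
    then have D_I: "D = (\<Sum>p\<in>V0. I p * u p)" by (simp add: gu)
    also have "\<dots> = M * sum I V0 + (\<Sum>p\<in>V0. r' p * (I p)\<^sup>2)"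
      unfolding sum_distrib_left sum.distrib[symmetric]
      by (intro sum.cong refl) (simp add: u power2_eq_square algebra_simps)
    also have "\<dots> = star_energy r' u"
      using star_energy_flow[OF r' I u] I by simp
    finally have D: "star_energy r' u = D" ..
    have lower: "D \<le> energy C (Suc n) v" if v: "\<forall>p\<in>V0. v p = u p" for v
    proof -
      have "D = 2 * (\<Sum>p\<in>V0. I p * v p) - D" using D_I v by simp
      also have "\<dots> = (\<Sum>d\<in>C. 2 * (\<Sum>p\<in>V0. i d p * v (cell_map d p)) - (\<Sum>p\<in>V0. r p * (i d p)\<^sup>2))"
        by (simp add: sum_subtractf D_def kirchhoff flip: sum_distrib_left)
      also have "\<dots> \<le> (\<Sum>d\<in>C. energy C n (v \<circ> cell_map d))"
      proof (rule sum_mono)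
        fix d assume d: "d \<in> C"
        have "2 * (\<Sum>p\<in>V0. i d p * v (cell_map d p)) - (\<Sum>p\<in>V0. r p * (i d p)\<^sup>2)
            \<le> star_energy r (v \<circ> cell_map d)"
          using star_energy_dual[of r "i d" "v \<circ> cell_map d", OF r_pos i[OF d]] by simp
        also have "\<dots> \<le> energy C n (v \<circ> cell_map d)"
          using r_min[of "v \<circ> cell_map d"] by (simp add: is_minimum_image_iff)
        finally show "2 * (\<Sum>p\<in>V0. i d p * v (cell_map d p)) - (\<Sum>p\<in>V0. r p * (i d p)\<^sup>2)
            \<le> energy C n (v \<circ> cell_map d)" .
      qed
      also have "\<dots> = energy C (Suc n) v" by (simp add: energy_Suc C(1))
      finally show ?thesis .
    qed
    have "\<exists>f. (\<forall>p\<in>V0. f p = g (cell_map d p)) \<and> energy C n f = star_energy r (g \<circ> cell_map d)" for d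
      using r_min[of "g \<circ> cell_map d"] by (simp add: is_minimum_image_iff)
    then obtain f where f: "\<And>d p. p \<in> V0 \<Longrightarrow> f d p = g (cell_map d p)"
      and f_energy: "\<And>d. energy C n (f d) = star_energy r (g \<circ> cell_map d)"
      by metis
    obtain v where v: "\<And>d x. d \<in> C \<Longrightarrow> x \<in> convex hull V0 \<Longrightarrow> v (cell_map d x) = f d x"
      by (rule glue_cells[of C f g]) (use f in auto)
    have "energy C (Suc n) v = (\<Sum>d\<in>C. energy C n (f d))"
      unfolding energy_Suc[OF C(1)]
      by (intro sum.cong refl energy_cong) (simp add: v subsetD[OF V_subset_hull[OF C(2)]])
    also have "\<dots> = D" by (simp add: f_energy cell_D D_def)
    finally have "energy C (Suc n) v = D" .
    moreover have "v p = u p" if p: "p \<in> V0" for p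
    proof -
      obtain d q where dq: "d \<in> C" "q \<in> V0" "p = cell_map d q" using C(3) p by blast
      then have "v p = g p" by (simp add: v f subsetD[OF V0_subset_hull])
      then show ?thesis using gu[OF p] by simp
    qed
    ultimately show ?thesis
      unfolding D is_minimum_image_iff using lower by blast
  qed
  then show ?thesis using r' by (simp add: equivalent_star_def)
qed

section \<open>The chain of right cells\<close>

locale sickle =
  fixes c :: "nat \<Rightarrow> nat \<times> nat" and z :: "nat \<Rightarrow> point"
  assumes chain: "right_chain c z"
begin

lemma right_cell_level: "k \<in> {1..9} \<Longrightarrow> fst (c k) + snd (c k) \<le> 6"
  using chain by (simp add: right_chain_def)

lemma z_0: "z 0 = lattice_pt 2 5"
  using chain by (simp add: right_chain_def)

lemma z_9: "z 9 = p2"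
  using chain by (simp add: right_chain_def lattice_pt_V0)

lemma junctions_distinct: "k \<in> {1..9} \<Longrightarrow> z (k - 1) \<noteq> z k"
  using chain by (simp add: right_chain_def)

lemma junctions:
  assumes "k \<in> {1..9}"
  shows "\<exists>a\<in>V0. \<exists>b\<in>V0. a \<noteq> b \<and> z (k - 1) = cell_map (c k) a \<and> z k = cell_map (c k) b"
proof -
  have "{z (k - 1), z k} \<subseteq> cell_map (c k) ` V0"
    using chain assms by (simp add: right_chain_def)
  then obtain a b where "a \<in> V0" "b \<in> V0" "z (k - 1) = cell_map (c k) a" "z k = cell_map (c k) b"
    by blast
  then show ?thesis using junctions_distinct[OF assms] by metis
qed

lemma junction_in_cell:
  assumes "k \<in> {1..9}"
  shows "z (k - 1) \<in> cell (c k)" "z k \<in> cell (c k)"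
  using junctions[OF assms] corner_in_cell by metis+

lemma consecutive_cells: "k \<in> {1..8} \<Longrightarrow> cell (c k) \<inter> cell (c (k + 1)) = {z k}"
  using chain unfolding right_chain_def by blast

lemma nonconsecutive_cells:
  "k \<in> {1..9} \<Longrightarrow> l \<in> {1..9} \<Longrightarrow> k + 1 < l \<Longrightarrow> cell (c k) \<inter> cell (c l) = {}"
  using chain unfolding right_chain_def by blast

lemma left_top_meets_right:
  assumes "d \<in> left_cells \<union> top_cells" "k \<in> {1..9}" "x \<in> cell d" "x \<in> cell (c k)"
  shows "x = z 0"
proof -
  have "(\<Union>k\<in>{1..9}. cell (c k)) \<inter> (\<Union>d\<in>left_cells \<union> top_cells. cell d) = {z 0}"
    using chain unfolding right_chain_def by blast
  then show ?thesis using assms by blast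
qed

text \<open>The next lemmas derive from the pairwise intersection properties that the right cells form a path
  without self-contacts: all junctions differ, and each right cell contains no junctions but its own
  two.\<close>

lemma right_cells_meet:
  assumes k: "k \<in> {1..9}" "l \<in> {1..9}" "k < l" and x: "x \<in> cell (c k)" "x \<in> cell (c l)"
  shows "l = k + 1 \<and> x = z k"
proof -
  have l: "l = k + 1" using nonconsecutive_cells[OF k(1,2)] k(3) x by fastforce
  then have "k \<in> {1..8}" using k by auto
  then show ?thesis using consecutive_cells[of k] x l by blast
qed

lemma junction_cells:
  assumes k: "k \<in> {1..9}" and l: "l \<le> 9" and zl: "z l \<in> cell (c k)"
  shows "l = k \<or> l = k - 1"
proof (cases "l = 0")
  case True
  have "k = 1"
  proof (rule ccontr)
    assume "k \<noteq> 1"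
    then have "k = 2 \<and> z 0 = z 1"
      using right_cells_meet[of 1 k "z 0"] junction_in_cell(1)[of 1] k zl True by auto
    then show False using junctions_distinct[of 1] by simp
  qed
  then show ?thesis using True by simp
next
  case False
  then have l9: "l \<in> {1..9}" using l by simp
  consider "l = k" | "l < k" | "k < l" by linarith
  then show ?thesis
  proof cases
    case 2
    then show ?thesis using right_cells_meet[OF l9 k 2 _ zl] junction_in_cell(2)[OF l9] by auto
  next
    case 3
    then have "l = k + 1 \<and> z l = z k"
      using right_cells_meet[OF k l9 3 zl] junction_in_cell(2)[OF l9] by auto
    then show ?thesis using junctions_distinct[OF l9] by auto
  qed simp
qed

lemma z_less_neq:
  assumes "k < l" "l \<le> 9"
  shows "z k \<noteq> z l"
proof
  assume eq: "z k = z l"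
  have l: "l \<in> {1..9}" using assms by simp
  have "z k \<in> cell (c l)" using junction_in_cell(2)[OF l] eq by simp
  then have "k = l - 1" using junction_cells[OF l, of k] assms by auto
  then show False using junctions_distinct[OF l] eq by simp
qed

lemma z_inj: "inj_on z {0..9}"
  by (rule linorder_inj_onI') (use z_less_neq in auto)

lemma c_inj: "inj_on c {1..9}"
proof (rule linorder_inj_onI')
  fix k l :: nat assume kl: "k \<in> {1..9}" "l \<in> {1..9}" "k < l"
  show "c k \<noteq> c l"
  proof
    assume "c k = c l"
    then have "z (k - 1) \<in> cell (c l)" using junction_in_cell(1)[OF kl(1)] by simp
    moreover have "k - 1 \<le> 9" using kl by simp
    ultimately have "k - 1 = l \<or> k - 1 = l - 1" using junction_cells[OF kl(2)] by blast
    then show False using kl by auto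
  qed
qed

lemma right_not_left_top:
  assumes k: "k \<in> {1..9}"
  shows "c k \<notin> left_cells \<union> top_cells"
proof
  assume d: "c k \<in> left_cells \<union> top_cells"
  have "z (k - 1) = z k"
    using left_top_meets_right[OF d k] junction_in_cell[OF k] by metis
  then show False using junctions_distinct[OF k] by simp
qed

lemma sum_sickle_cells:
  "sum f (sickle_cells c) =
     (\<Sum>j<5. f (0, j)) + f (0, 5) + f (1, 5) + f (0, 6) + (\<Sum>k=1..9. f (c k))"
proof -
  have "sum f (sickle_cells c) = sum f (left_cells \<union> top_cells) + sum f (c ` {1..9})"
    unfolding sickle_cells_def
  proof (rule sum.union_disjoint)
    show "(left_cells \<union> top_cells) \<inter> c ` {1..9} = {}" using right_not_left_top by blast
  qed (simp_all add: left_cells_def top_cells_def)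
  also have "sum f (c ` {1..9}) = (\<Sum>k=1..9. f (c k))"
    unfolding sum.reindex[OF c_inj] by simp
  also have "sum f (left_cells \<union> top_cells) =
      (\<Sum>j<5. f (0, j)) + f (0, 5) + f (1, 5) + f (0, 6)"
    by (simp add: left_cells_def top_cells_def eval_nat_numeral ac_simps)
  finally show ?thesis by simp
qed

lemma ball_sickle_cells:
  "(\<forall>d\<in>sickle_cells c. P d) \<longleftrightarrow>
     (\<forall>j<5. P (0, j)) \<and> P (0, 5) \<and> P (1, 5) \<and> P (0, 6) \<and> (\<forall>k\<in>{1..9}. P (c k))"
proof -
  have "(\<forall>d\<in>left_cells. P d) \<longleftrightarrow> (\<forall>j<5. P (0, j))"
    by (auto simp: left_cells_def eval_nat_numeral less_Suc_eq)
  then show ?thesis unfolding sickle_cells_def top_cells_def ball_Un by simp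
qed

lemma sickle_cells_level: "\<forall>d\<in>sickle_cells c. fst d + snd d \<le> 6"
  unfolding ball_sickle_cells using right_cell_level by auto

lemma finite_sickle_cells: "finite (sickle_cells c)"
  by (simp add: sickle_cells_def left_cells_def top_cells_def)

lemma V0_in_sickle_corners: "V0 \<subseteq> (\<Union>d\<in>sickle_cells c. cell_map d ` V0)"
proof -
  have "(0, 0) \<in> sickle_cells c" "(0, 6) \<in> sickle_cells c" "c 9 \<in> sickle_cells c"
    by (auto simp: sickle_cells_def left_cells_def top_cells_def)
  moreover have "p1 = cell_map (0, 0) p1" "p3 = cell_map (0, 6) p3"
    by (simp_all add: lattice_pt_V0)
  moreover obtain b where "b \<in> V0" "p2 = cell_map (c 9) b"
    using junctions[of 9] z_9 by auto
  ultimately show ?thesis unfolding V0_def by blast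
qed

text \<open>Flows and centre potentials are prescribed cell by cell. This is consistent because the 17 cells
  are distinct.\<close>

lemma family_on_cells:
  obtains F where "\<And>j. j < 5 \<Longrightarrow> F (0, j) = L j" "F (0, 5) = T1" "F (1, 5) = T2" "F (0, 6) = T3"
    "\<And>k. k \<in> {1..9} \<Longrightarrow> F (c k) = R k"
proof -
  define F where "F d = (if d \<in> c ` {1..9} then R (inv_into {1..9} c d)
      else if d = (0, 5) then T1 else if d = (1, 5) then T2 else if d = (0, 6) then T3
      else L (snd d))" for d
  have "d \<notin> c ` {1..9}" if "d \<in> left_cells \<union> top_cells" for d
    using right_not_left_top that by blast
  moreover have "(0, j) \<in> left_cells \<union> top_cells" if "j < 5" for j
    using that by (auto simp: left_cells_def eval_nat_numeral less_Suc_eq)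
  moreover have "(0, 5) \<in> left_cells \<union> top_cells" "(1, 5) \<in> left_cells \<union> top_cells"
      "(0, 6) \<in> left_cells \<union> top_cells"
    by (auto simp: top_cells_def)
  ultimately show thesis
    by (intro that[of F]) (simp_all add: F_def inv_into_f_f[OF c_inj] del: One_nat_def)
qed

text \<open>A potential is prescribed by lattice coordinates (\<open>G\<close>) on the left and top cells, by \<open>h\<close> at the
  junctions of the right chain and by \<open>m\<close> at the remaining corners of the right cells. This is
  consistent because the chain has no self-contacts and touches the other cells only in \<open>z 0\<close>, which is
  the lattice point (2, 5).\<close>

lemma function_on_corners:
  assumes G: "G 2 5 = h 0"
  obtains g where
    "\<And>i j. (i, j) \<in> left_cells \<union> top_cells \<Longrightarrow> g (lattice_pt i j) = G i j"
    "\<And>i j. (i, j) \<in> left_cells \<union> top_cells \<Longrightarrow> g (lattice_pt (Suc i) j) = G (Suc i) j"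
    "\<And>i j. (i, j) \<in> left_cells \<union> top_cells \<Longrightarrow> g (lattice_pt i (Suc j)) = G i (Suc j)"
    "\<And>k. k \<le> 9 \<Longrightarrow> g (z k) = h k"
    "\<And>k x. k \<in> {1..9} \<Longrightarrow> x \<in> cell (c k) \<Longrightarrow> x \<noteq> z (k - 1) \<Longrightarrow> x \<noteq> z k \<Longrightarrow> g x = m k"
proof -
  define g where "g x = (if x \<in> z ` {0..9} then h (inv_into {0..9} z x)
      else if \<exists>k\<in>{1..9}. x \<in> cell (c k) then m (SOME k. k \<in> {1..9} \<and> x \<in> cell (c k))
      else (\<lambda>(i, j). G i j) (inv (\<lambda>(i, j). lattice_pt i j) x))" for x
  have g_z: "g (z k) = h k" if "k \<le> 9" for k
    using that by (simp add: g_def inv_into_f_f[OF z_inj])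
  have "inj (\<lambda>(i, j). lattice_pt i j)"
    using lattice_pt_inj by (auto simp: inj_def)
  then have inv_lattice: "inv (\<lambda>(i, j). lattice_pt i j) (lattice_pt i j) = (i, j)" for i j
    using inv_f_f[of "\<lambda>(i, j). lattice_pt i j" "(i, j)"] by simp
  have g_left_top: "g (lattice_pt i j) = G i j"
    if d: "d \<in> left_cells \<union> top_cells" and x: "lattice_pt i j \<in> cell d" for d i j
  proof (cases "\<exists>k\<in>{1..9}. lattice_pt i j \<in> cell (c k)")
    case True
    then have "lattice_pt i j = z 0" using left_top_meets_right[OF d] x by blast
    moreover from this have "i = 2" "j = 5" using lattice_pt_inj unfolding z_0 by metis+
    ultimately show ?thesis using g_z[of 0] G by simp
  next
    case False
    have "lattice_pt i j \<notin> z ` {0..9}"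
    proof
      assume "lattice_pt i j \<in> z ` {0..9}"
      then obtain l where l: "l \<le> 9" "lattice_pt i j = z l" by auto
      show False
      proof (cases "l = 0")
        case True
        then show False using \<open>\<not> (\<exists>k\<in>{1..9}. _ k)\<close> l junction_in_cell(1)[of 1] by auto
      next
        case nz: False
        then show False using False l junction_in_cell(2)[of l] by auto
      qed
    qed
    then show ?thesis using False by (simp add: g_def inv_lattice)
  qed
  have g_right: "g x = m k" if k: "k \<in> {1..9}" and x: "x \<in> cell (c k)" "x \<noteq> z (k - 1)" "x \<noteq> z k"
    for k x
  proof -
    have nz: "x \<notin> z ` {0..9}" using junction_cells[OF k] x by fastforce
    define l where "l = (SOME l. l \<in> {1..9} \<and> x \<in> cell (c l))"
    have l: "l \<in> {1..9} \<and> x \<in> cell (c l)"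
      unfolding l_def by (rule someI[of _ k]) (use k x in auto)
    have "l = k"
    proof (rule ccontr)
      assume "l \<noteq> k"
      then have "x = z k \<or> x = z l"
        using right_cells_meet[of k l x] right_cells_meet[of l k x] k l x(1) by (meson nat_neq_iff)
      then show False using nz k l by auto
    qed
    then show ?thesis using nz k x(1) unfolding g_def l_def by auto
  qed
  have "cell_map (i, j) p \<in> cell (i, j)" if "p \<in> V0" for i j p
    using corner_in_cell that by blast
  from this[of p1] this[of p2] this[of p3]
  have corners: "lattice_pt i j \<in> cell (i, j)" "lattice_pt (Suc i) j \<in> cell (i, j)"
      "lattice_pt i (Suc j) \<in> cell (i, j)" for i j
    by simp_all
  show thesis
    by (rule that[of g]) (use g_left_top corners g_z g_right in blast)+
qed

end

section \<open>The network of the first level\<close>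

definition corner_fun :: "'a \<Rightarrow> 'a \<Rightarrow> 'a \<Rightarrow> point \<Rightarrow> 'a" where
  "corner_fun a b c p = (if p = p1 then a else if p = p2 then b else c)"

lemma corner_fun_simps [simp]:
  "corner_fun a b c p1 = a" "corner_fun a b c p2 = b" "corner_fun a b c p3 = c"
  by (simp_all add: corner_fun_def)

text \<open>The arms of the star that replaces the network of 17 stars \<open>r\<close>. The terms with coefficients come from
  the left and the right chain, the other terms from the top: there the centres of the three stars form
  a triangle with resistors \<open>x12\<close>, \<open>x23\<close>, \<open>x31\<close>, whose sum is \<open>s\<close>; the quotients are the arms of its
  equivalent star.\<close>

definition next_star :: "(point \<Rightarrow> real) \<Rightarrow> point \<Rightarrow> real" where
  "next_star r =
     (let x12 = r p1 + r p2; x23 = r p2 + r p3; x31 = r p3 + r p1; s = 2 * (r p1 + r p2 + r p3)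
      in corner_fun (5 * x31 + r p1 + x12 * x31 / s)
           ((4 * x12 + 3 * x23 + 2 * x31) + r p2 + x12 * x23 / s)
           (r p3 + x31 * x23 / s))"

lemma next_star_pos:
  assumes "\<And>p. p \<in> V0 \<Longrightarrow> r p > 0" "p \<in> V0"
  shows "next_star r p > 0"
proof -
  have "r p1 > 0" "r p2 > 0" "r p3 > 0" by (simp_all add: assms(1))
  then show ?thesis using assms(2)
    by (auto simp: V0_def next_star_def Let_def intro!: add_pos_pos divide_pos_pos mult_pos_pos)
qed

primrec star_res :: "nat \<Rightarrow> point \<Rightarrow> real" where
  "star_res 0 = (\<lambda>_. 1/3)"
| "star_res (Suc n) = next_star (star_res n)"

context sickle
begin

text \<open>A right cell with entrance \<open>a\<close> and exit \<open>b\<close> contributes the two arms \<open>r a + r b\<close>, in either direction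
  of passage, so the resistance of the chain depends only on the numbers of cells of each kind.\<close>

lemma right_resistance:
  fixes r :: "point \<Rightarrow> real"
  obtains \<rho> where
    "\<And>k a b. k \<in> {1..9} \<Longrightarrow> a \<in> V0 \<Longrightarrow> b \<in> V0 \<Longrightarrow> z (k - 1) = cell_map (c k) a \<Longrightarrow>
       z k = cell_map (c k) b \<Longrightarrow> \<rho> k = r a + r b"
    "(\<Sum>k=1..9. \<rho> k) = 4 * (r p1 + r p2) + 3 * (r p2 + r p3) + 2 * (r p3 + r p1)"
proof -
  define T where "T a b = {k\<in>{1..9}. {z (k - 1), z k} = cell_map (c k) ` {a, b}}" for a b
  define \<rho> where "\<rho> k = of_bool (k \<in> T p1 p2) * (r p1 + r p2) + of_bool (k \<in> T p2 p3) * (r p2 + r p3)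
    + of_bool (k \<in> T p3 p1) * (r p3 + r p1)" for k
  have card: "card (T p1 p2) = 4" "card (T p2 p3) = 3" "card (T p3 p1) = 2"
    using chain by (simp_all add: right_chain_def T_def)
  have sum_T: "(\<Sum>k=1..9. of_bool (k \<in> T a b) * x) = card (T a b) * x" for a b and x :: real
  proof -
    have "{1..9} \<inter> T a b = T a b" by (auto simp: T_def)
    then show ?thesis
      by (simp add: of_bool_def if_distrib[of "\<lambda>y. y * x"] flip: sum.inter_restrict cong: if_cong)
  qed
  have "(\<Sum>k=1..9. \<rho> k) = 4 * (r p1 + r p2) + 3 * (r p2 + r p3) + 2 * (r p3 + r p1)"
    unfolding \<rho>_def sum.distrib sum_T card by simp
  moreover have "\<rho> k = r a + r b" if k: "k \<in> {1..9}" and ab: "a \<in> V0" "b \<in> V0"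
    and z: "z (k - 1) = cell_map (c k) a" "z k = cell_map (c k) b" for k a b
  proof -
    have T: "k \<in> T u v \<longleftrightarrow> {a, b} = {u, v}" for u v
    proof -
      have "{z (k - 1), z k} = cell_map (c k) ` {a, b}" using z by simp
      then have "k \<in> T u v \<longleftrightarrow> cell_map (c k) ` {a, b} = cell_map (c k) ` {u, v}"
        using k unfolding T_def by blast
      then show ?thesis by (simp only: inj_image_eq_iff[OF cell_map_inj])
    qed
    have "a \<noteq> b" using junctions_distinct[OF k] z by auto
    then show ?thesis using ab unfolding \<rho>_def T V0_def
      by (auto simp: doubleton_eq_iff)
  qed
  ultimately show thesis using that by blast
qed

text \<open>The current \<open>I p1\<close> climbs the left chain and \<open>I p2\<close> runs backwards along the right chain, both towards
  the top, where the three currents meet. Third corners of chain cells carry no current and take the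
  potential of the centre of their cell.\<close>

lemma sickle_network:
  fixes r I :: "point \<Rightarrow> real"
  assumes r: "\<And>p. p \<in> V0 \<Longrightarrow> r p > 0" and I: "sum I V0 = 0"
  shows "\<exists>i m g.
      (\<forall>d\<in>sickle_cells c. sum (i d) V0 = 0) \<and>
      (\<forall>d\<in>sickle_cells c. \<forall>p\<in>V0. g (cell_map d p) = m d + r p * i d p) \<and>
      (\<forall>w. (\<Sum>d\<in>sickle_cells c. \<Sum>p\<in>V0. i d p * w (cell_map d p)) = (\<Sum>p\<in>V0. I p * w p)) \<and>
      (\<forall>p\<in>V0. g p = next_star r p * I p)"
proof -
  define x12 where "x12 = r p1 + r p2"
  define x23 where "x23 = r p2 + r p3"
  define x31 where "x31 = r p3 + r p1"
  define s where "s = 2 * (r p1 + r p2 + r p3)"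
  have "r p1 > 0" "r p2 > 0" "r p3 > 0" by (simp_all add: r)
  then have s: "s > 0" by (simp add: s_def)
  have s_eq: "s = x12 + x23 + x31" by (simp add: s_def x12_def x23_def x31_def)
  have I3: "I p3 = - I p1 - I p2" using I by (simp add: sum_V0)
  \<comment> \<open>The centre of the top triangle's equivalent star has potential 0, so that \<open>M1\<close>, \<open>M2\<close>, \<open>M3\<close> are
    the potentials of the centres of the three top cells. The currents that enter the lower left top
    cell from its two neighbours are \<open>\<alpha>\<close> and \<open>\<beta>\<close>, and \<open>\<gamma>\<close> enters the lower right one from the upper one.\<close>
  define \<alpha> where "\<alpha> = (x23 * I p2 - x31 * I p1) / s"
  define \<beta> where "\<beta> = (x23 * I p3 - x12 * I p1) / s"
  define \<gamma> where "\<gamma> = (x31 * I p3 - x12 * I p2) / s"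
  define M1 where "M1 = x12 * x31 / s * I p1"
  define M2 where "M2 = x12 * x23 / s * I p2"
  define M3 where "M3 = x31 * x23 / s * I p3"
  have balance: "I p1 + \<alpha> + \<beta> = 0" "- \<alpha> + I p2 + \<gamma> = 0" "- \<beta> - \<gamma> + I p3 = 0"
    using s by (simp_all add: \<alpha>_def \<beta>_def \<gamma>_def I3 field_simps) (simp_all add: s_eq algebra_simps)
  have ohm: "M1 + r p2 * \<alpha> = M2 - r p1 * \<alpha>" "M1 + r p3 * \<beta> = M3 - r p1 * \<beta>"
      "M2 + r p3 * \<gamma> = M3 - r p2 * \<gamma>"
  proof -
    have "x12 * \<alpha> = M2 - M1" "x31 * \<beta> = M3 - M1" "x23 * \<gamma> = M3 - M2"
      by (simp_all add: \<alpha>_def \<beta>_def \<gamma>_def M1_def M2_def M3_def diff_divide_distrib[symmetric] algebra_simps)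
    then show "M1 + r p2 * \<alpha> = M2 - r p1 * \<alpha>" "M1 + r p3 * \<beta> = M3 - r p1 * \<beta>"
      "M2 + r p3 * \<gamma> = M3 - r p2 * \<gamma>"
      by (simp_all add: x12_def x23_def x31_def algebra_simps)
  qed
  \<comment> \<open>The potentials along the left border are \<open>G0\<close>. In \<open>G\<close>, the column \<open>i = 1\<close> has the dead ends of the
    left cells below the top, and the last case is needed only for the lattice point (2, 5).\<close>
  define G0 where "G0 j = (if j \<le> 5 then M1 + r p1 * I p1 + real (5 - j) * x31 * I p1
      else if j = 6 then M1 + r p3 * \<beta> else M3 + r p3 * I p3)" for j :: nat
  define G where "G i j = (if i = 0 then G0 j
      else if i = 1 then (if j \<le> 4 then G0 j - r p1 * I p1
        else if j = 5 then M1 + r p2 * \<alpha> else M2 + r p3 * \<gamma>)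
      else M2 + r p2 * I p2)" for i j :: nat
  obtain \<rho> where \<rho>: "\<And>k a b. k \<in> {1..9} \<Longrightarrow> a \<in> V0 \<Longrightarrow> b \<in> V0 \<Longrightarrow> z (k - 1) = cell_map (c k) a \<Longrightarrow>
       z k = cell_map (c k) b \<Longrightarrow> \<rho> k = r a + r b"
    and sum_\<rho>: "(\<Sum>k=1..9. \<rho> k) = 4 * x12 + 3 * x23 + 2 * x31"
    using right_resistance[of r] unfolding x12_def x23_def x31_def by blast
  \<comment> \<open>The chain is traversed from \<open>z 0\<close> to \<open>p2\<close>, against the current, so the potential increases by
    \<open>\<rho> k * I p2\<close> in the \<open>k\<close>-th cell.\<close>
  define h where "h k = M2 + r p2 * I p2 + (\<Sum>l=1..k. \<rho> l) * I p2" for k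
  obtain a b where ab: "\<And>k. k \<in> {1..9} \<Longrightarrow> a k \<in> V0 \<and> b k \<in> V0 \<and> a k \<noteq> b k \<and>
      z (k - 1) = cell_map (c k) (a k) \<and> z k = cell_map (c k) (b k)"
    using junctions by metis
  have h_step: "h k = h (k - 1) + (r (a k) + r (b k)) * I p2" if k: "k \<in> {1..9}" for k
  proof -
    obtain k' where "k = Suc k'" using k by (cases k) auto
    moreover have "\<rho> k = r (a k) + r (b k)" using \<rho>[OF k] ab[OF k] by blast
    ultimately show ?thesis by (simp add: h_def algebra_simps)
  qed
  have G_h: "G 2 5 = h 0" by (simp add: G_def h_def)
  obtain g where
    g_left_top: "\<And>i j. (i, j) \<in> left_cells \<union> top_cells \<Longrightarrow> g (lattice_pt i j) = G i j"
    "\<And>i j. (i, j) \<in> left_cells \<union> top_cells \<Longrightarrow> g (lattice_pt (Suc i) j) = G (Suc i) j"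
    "\<And>i j. (i, j) \<in> left_cells \<union> top_cells \<Longrightarrow> g (lattice_pt i (Suc j)) = G i (Suc j)"
    and g_z: "\<And>k. k \<le> 9 \<Longrightarrow> g (z k) = h k"
    and g_right: "\<And>k x. k \<in> {1..9} \<Longrightarrow> x \<in> cell (c k) \<Longrightarrow> x \<noteq> z (k - 1) \<Longrightarrow> x \<noteq> z k \<Longrightarrow>
      g x = h k - r (b k) * I p2"
    by (rule function_on_corners[of G h "\<lambda>k. h k - r (b k) * I p2", OF G_h]) (rule that)
  obtain i where i: "\<And>j. j < 5 \<Longrightarrow> i (0, j) = corner_fun (I p1) 0 (- I p1)"
    "i (0, 5) = corner_fun (I p1) \<alpha> \<beta>" "i (1, 5) = corner_fun (- \<alpha>) (I p2) \<gamma>"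
    "i (0, 6) = corner_fun (- \<beta>) (- \<gamma>) (I p3)"
    and i_right: "\<And>k. k \<in> {1..9} \<Longrightarrow> i (c k) = (\<lambda>p. I p2 * (of_bool (p = b k) - of_bool (p = a k)))"
    by (rule family_on_cells) (rule that)
  obtain m where m: "\<And>j. j < 5 \<Longrightarrow> m (0, j) = G0 j - r p1 * I p1"
    "m (0, 5) = M1" "m (1, 5) = M2" "m (0, 6) = M3"
    and m_right: "\<And>k. k \<in> {1..9} \<Longrightarrow> m (c k) = h k - r (b k) * I p2"
    by (rule family_on_cells) (rule that)
  have left_top: "(0, 5) \<in> left_cells \<union> top_cells" "(1, 5) \<in> left_cells \<union> top_cells"
      "(0, 6) \<in> left_cells \<union> top_cells" "\<And>j. j < 5 \<Longrightarrow> (0, j) \<in> left_cells \<union> top_cells"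
    by (auto simp: left_cells_def top_cells_def eval_nat_numeral less_Suc_eq)
  have right_flow: "(\<Sum>p\<in>V0. i (c k) p * w (cell_map (c k) p)) = I p2 * (w (z k) - w (z (k - 1)))"
    if k: "k \<in> {1..9}" for k and w :: "point \<Rightarrow> real"
    using ab[OF k] by (auto simp: sum_V0 i_right[OF k] V0_def algebra_simps)
  have "\<forall>d\<in>sickle_cells c. sum (i d) V0 = 0"
    unfolding ball_sickle_cells
  proof (intro conjI allI ballI impI)
    fix k :: nat assume k: "k \<in> {1..9}"
    show "sum (i (c k)) V0 = 0" using right_flow[OF k, of "\<lambda>_. 1"] by simp
  qed (use balance i in \<open>auto simp: sum_V0\<close>)
  moreover have "\<forall>d\<in>sickle_cells c. \<forall>p\<in>V0. g (cell_map d p) = m d + r p * i d p"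
    unfolding ball_sickle_cells
  proof (intro conjI allI ballI impI)
    fix k :: nat and p :: point assume k: "k \<in> {1..9}" and p: "p \<in> V0"
    note abk = ab[OF k]
    consider "p = a k" | "p = b k" | "p \<noteq> a k" "p \<noteq> b k" by blast
    then show "g (cell_map (c k) p) = m (c k) + r p * i (c k) p"
    proof cases
      case 1
      then have "g (cell_map (c k) p) = h (k - 1)" using abk g_z[of "k - 1"] k by auto
      then show ?thesis using 1 abk h_step[OF k] by (simp add: m_right[OF k] i_right[OF k] algebra_simps)
    next
      case 2
      then have "g (cell_map (c k) p) = h k" using abk g_z[of k] k by auto
      then show ?thesis using 2 abk by (auto simp: m_right[OF k] i_right[OF k])
    next
      case 3
      then have "g (cell_map (c k) p) = h k - r (b k) * I p2"
        using g_right[OF k corner_in_cell[OF p]] abk by simp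
      then show ?thesis using 3 by (simp add: m_right[OF k] i_right[OF k])
    qed
  next
    fix j :: nat and p assume j: "j < 5" and p: "p \<in> V0"
    have "G0 (Suc j) = G0 j - x31 * I p1" using j by (simp add: G0_def of_nat_diff algebra_simps)
    then show "g (cell_map (0, j) p) = m (0, j) + r p * i (0, j) p"
      using p j g_left_top[OF left_top(4)[OF j]]
      by (auto simp: V0_def i m G_def x31_def algebra_simps)
  next
    fix p assume p: "p \<in> V0"
    show "g (cell_map (0, 5) p) = m (0, 5) + r p * i (0, 5) p"
      using p g_left_top[OF left_top(1)] by (auto simp: V0_def i m G_def G0_def)
    show "g (cell_map (1, 5) p) = m (1, 5) + r p * i (1, 5) p"
      using p g_left_top[OF left_top(2)] ohm by (auto simp: V0_def i[simplified] m[simplified] G_def G0_def)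
    show "g (cell_map (0, 6) p) = m (0, 6) + r p * i (0, 6) p"
      using p g_left_top[OF left_top(3)] ohm by (auto simp: V0_def i m G_def G0_def)
  qed
  moreover have "(\<Sum>d\<in>sickle_cells c. \<Sum>p\<in>V0. i d p * w (cell_map d p)) = (\<Sum>p\<in>V0. I p * w p)" for w
  proof -
    have left: "(\<Sum>j<5. \<Sum>p\<in>V0. i (0, j) p * w (cell_map (0, j) p)) = I p1 * (w p1 - w (lattice_pt 0 5))"
    proof -
      have "(\<Sum>j<5. \<Sum>p\<in>V0. i (0, j) p * w (cell_map (0, j) p))
          = (\<Sum>j<5. I p1 * (w (lattice_pt 0 j) - w (lattice_pt 0 (Suc j))))"
        by (intro sum.cong refl) (simp add: sum_V0 i algebra_simps)
      also have "\<dots> = I p1 * (w p1 - w (lattice_pt 0 5))"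
        by (simp only: sum_distrib_left[symmetric] sum_lessThan_telescope'[of "\<lambda>j. w (lattice_pt 0 j)"] lattice_pt_V0)
      finally show ?thesis .
    qed
    have right: "(\<Sum>k=1..9. \<Sum>p\<in>V0. i (c k) p * w (cell_map (c k) p)) = I p2 * (w p2 - w (lattice_pt 2 5))"
    proof -
      have "(\<Sum>k=1..9. \<Sum>p\<in>V0. i (c k) p * w (cell_map (c k) p))
          = (\<Sum>k=Suc 0..9. I p2 * (w (z k) - w (z (k - 1))))"
        by (intro sum.cong) (simp_all add: right_flow)
      also have "\<dots> = I p2 * (w p2 - w (lattice_pt 2 5))"
        by (simp only: sum_distrib_left[symmetric])
          (simp add: sum_telescope''[of 0 9 "\<lambda>k. w (z k)", simplified] z_0 z_9)
      finally show ?thesis .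
    qed
    have top: "(\<Sum>p\<in>V0. i (0, 5) p * w (cell_map (0, 5) p)) + (\<Sum>p\<in>V0. i (1, 5) p * w (cell_map (1, 5) p))
        + (\<Sum>p\<in>V0. i (0, 6) p * w (cell_map (0, 6) p))
        = I p1 * w (lattice_pt 0 5) + I p2 * w (lattice_pt 2 5) + I p3 * w p3"
      by (simp add: sum_V0 i[simplified] lattice_pt_V0 numeral_2_eq_2)
    show ?thesis
      unfolding sum_sickle_cells left right using top by (simp add: sum_V0 algebra_simps)
  qed
  moreover have "\<forall>p\<in>V0. g p = next_star r p * I p"
  proof -
    have "g p1 = G 0 0" using g_left_top(1)[of 0 0] left_top(4)[of 0] by (simp add: lattice_pt_V0)
    then have "g p1 = next_star r p1 * I p1"
      by (simp add: G_def G0_def M1_def next_star_def Let_def x12_def x23_def x31_def s_def algebra_simps)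
    moreover have "g p2 = h 9" using g_z[of 9] by (simp add: z_9)
    then have "g p2 = next_star r p2 * I p2"
      unfolding h_def sum_\<rho>
      by (simp add: M2_def next_star_def Let_def x12_def x23_def x31_def s_def algebra_simps)
    moreover have "g p3 = G 0 7" using g_left_top(3)[of 0 6] left_top(3) by (simp add: lattice_pt_V0)
    then have "g p3 = next_star r p3 * I p3"
      by (simp add: G_def G0_def M3_def next_star_def Let_def x12_def x23_def x31_def s_def algebra_simps)
    ultimately show ?thesis by (auto simp: V0_def)
  qed
  ultimately show ?thesis by blast
qed

lemma sickle_equivalent_star: "equivalent_star (sickle_cells c) n (star_res n)"
proof (induction n)
  case 0
  then show ?case by (simp add: equivalent_star_0)
next
  case (Suc n)
  then have pos: "\<And>p. p \<in> V0 \<Longrightarrow> star_res n p > 0" by (simp add: equivalent_star_def)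
  show ?case
    unfolding star_res.simps
  proof (rule equivalent_star_Suc[OF finite_sickle_cells sickle_cells_level V0_in_sickle_corners Suc])
    show "next_star (star_res n) p > 0" if "p \<in> V0" for p
      by (rule next_star_pos[of "star_res n", OF pos that])
  qed (rule sickle_network[OF pos])
qed

end

section \<open>Growth of the star resistances\<close>

text \<open>Between \<open>p3\<close> and \<open>p1\<close> the five left cells and the outer arms of two top cells contribute six times
  \<open>r p3 + r p1\<close>. The seventh part is an edge of the top triangle, and the deviation from the factor 7
  comes from the detour along its other two edges.\<close>

lemma next_star_path:
  assumes r: "\<And>p. p \<in> V0 \<Longrightarrow> r p > 0"
  shows "next_star r p3 + next_star r p1 =
    7 * (r p3 + r p1) - (r p3 + r p1)\<^sup>2 / (2 * (r p1 + r p2 + r p3))"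
proof -
  define s where "s = 2 * (r p1 + r p2 + r p3)"
  have "r p1 > 0" "r p2 > 0" "r p3 > 0" by (simp_all add: r)
  then have "s \<noteq> 0" by (simp add: s_def)
  have "next_star r p3 + next_star r p1 =
      6 * (r p3 + r p1) + (r p3 + r p1) * (s - (r p3 + r p1)) / s"
    by (simp add: next_star_def Let_def flip: s_def) (simp add: s_def add_divide_distrib[symmetric] algebra_simps)
  also have "\<dots> = 7 * (r p3 + r p1) - (r p3 + r p1)\<^sup>2 / s"
    using \<open>s \<noteq> 0\<close> by (simp add: field_simps power2_eq_square)
  finally show ?thesis by (simp add: s_def)
qed

lemma next_star_p2_bounds:
  assumes r: "\<And>p. p \<in> V0 \<Longrightarrow> r p > 0"
  shows "17/2 * r p2 \<le> next_star r p2" "next_star r p2 \<le> 17/2 * r p2 + 13/2 * (r p3 + r p1)"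
proof -
  define s where "s = 2 * (r p1 + r p2 + r p3)"
  have pos: "r p1 > 0" "r p2 > 0" "r p3 > 0" by (simp_all add: r)
  then have "s > 0" by (simp add: s_def)
  then have "(r p1 + r p2) * (r p2 + r p3) / s = r p2 / 2 + r p1 * r p3 / s"
    by (simp add: field_simps) (simp add: s_def algebra_simps)
  then have eq: "next_star r p2 = 17/2 * r p2 + 6 * r p1 + 5 * r p3 + r p1 * r p3 / s"
    by (simp add: next_star_def Let_def s_def)
  have "r p1 * r p3 / s \<ge> 0" using pos \<open>s > 0\<close> by simp
  then show "17/2 * r p2 \<le> next_star r p2" unfolding eq using pos by linarith
  have "r p3 / s \<le> 1 / 2" using pos \<open>s > 0\<close> by (simp add: field_simps) (simp add: s_def)
  then have "r p1 * (r p3 / s) \<le> r p1 * (1 / 2)" using pos by (intro mult_left_mono) auto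
  then show "next_star r p2 \<le> 17/2 * r p2 + 13/2 * (r p3 + r p1)"
    unfolding eq using pos by simp
qed

text \<open>Each of the arms at \<open>p1\<close> and \<open>p3\<close> receives a fixed fraction of the old sum of the two, so neither can
  become small compared with the other.\<close>

lemma next_star_balanced:
  assumes r: "\<And>p. p \<in> V0 \<Longrightarrow> r p > 0" and x: "r p3 + r p1 \<le> 2 * r p2"
  shows "(r p3 + r p1) / 6 \<le> next_star r p3" "5 * (r p3 + r p1) \<le> next_star r p1"
proof -
  define s where "s = 2 * (r p1 + r p2 + r p3)"
  have pos: "r p1 > 0" "r p2 > 0" "r p3 > 0" by (simp_all add: r)
  then have "s > 0" by (simp add: s_def)
  have "1 / 6 \<le> (r p2 + r p3) / s"
    using pos x \<open>s > 0\<close> by (simp add: field_simps) (simp add: s_def)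
  then have "(r p3 + r p1) * (1 / 6) \<le> (r p3 + r p1) * ((r p2 + r p3) / s)"
    using pos by (intro mult_left_mono) auto
  then show "(r p3 + r p1) / 6 \<le> next_star r p3"
    using pos by (simp add: next_star_def Let_def s_def)
  have "(r p1 + r p2) * (r p3 + r p1) / s \<ge> 0" using pos \<open>s > 0\<close> by simp
  then show "5 * (r p3 + r p1) \<le> next_star r p1"
    using pos by (simp add: next_star_def Let_def s_def)
qed

lemma star_res_pos: "p \<in> V0 \<Longrightarrow> star_res n p > 0"
  by (induction n arbitrary: p) (auto intro: next_star_pos)

lemma star_res_p2_lower: "1/3 * (17/2) ^ n \<le> star_res n p2"
proof (induction n)
  case (Suc n)
  then show ?case using next_star_p2_bounds(1)[of "star_res n", OF star_res_pos] by simp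
qed simp

lemma path_step_le: "star_res (Suc n) p3 + star_res (Suc n) p1 \<le> 7 * (star_res n p3 + star_res n p1)"
proof -
  have "star_res n p1 + star_res n p2 + star_res n p3 > 0"
    by (simp add: star_res_pos add_pos_pos)
  then have "0 \<le> (star_res n p3 + star_res n p1)\<^sup>2 / (2 * (star_res n p1 + star_res n p2 + star_res n p3))"
    by simp
  then show ?thesis
    using next_star_path[of "star_res n", OF star_res_pos] by simp
qed

lemma path_upper: "star_res n p3 + star_res n p1 \<le> 2/3 * 7 ^ n"
proof (induction n)
  case (Suc n)
  then show ?case using path_step_le[of n] by simp
qed simp

text \<open>The step for \<open>r p2\<close> has the inhomogeneous term \<open>13/2 x\<close>. It is absorbed by bounding \<open>r p2 + a x\<close> instead,
  which grows by at most the factor \<open>17/2\<close> as soon as \<open>13/2 + 7 a \<le> 17/2 a\<close>; hence \<open>a = 13/3\<close>.\<close>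

lemma star_res_p2_upper: "star_res n p2 \<le> 29/9 * (17/2) ^ n"
proof -
  have "star_res n p2 + 13/3 * (star_res n p3 + star_res n p1) \<le> 29/9 * (17/2) ^ n"
  proof (induction n)
    case (Suc n)
    have "next_star (star_res n) p2 \<le>
        17/2 * star_res n p2 + 13/2 * (star_res n p3 + star_res n p1)"
      by (rule next_star_p2_bounds(2)[OF star_res_pos])
    then show ?case
      using Suc path_step_le[of n] unfolding power_Suc star_res.simps by argo
  qed simp
  then show ?thesis using star_res_pos[OF V0_mem(1), of n] star_res_pos[OF V0_mem(3), of n] by argo
qed

lemma path_le_p2: "star_res n p3 + star_res n p1 \<le> 2 * star_res n p2"
proof (induction n)
  case (Suc n)
  then show ?case
    using next_star_p2_bounds(1)[of "star_res n", OF star_res_pos] path_step_le[of n] star_res_pos[of p2 n]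
    by simp
qed simp

text \<open>The constant is \<open>6 * 7\<close>: the arm at \<open>p3\<close> is at least a sixth of the previous sum, and the sum grows by
  at most the factor 7.\<close>

lemma star_res_balanced:
  "star_res n p3 + star_res n p1 \<le> 42 * star_res n p3"
  "star_res n p3 + star_res n p1 \<le> 42 * star_res n p1"
proof -
  have "star_res n p3 + star_res n p1 \<le> 42 * star_res n p3 \<and>
      star_res n p3 + star_res n p1 \<le> 42 * star_res n p1"
  proof (cases n)
    case (Suc m)
    have "star_res m p3 + star_res m p1 > 0" by (simp add: star_res_pos add_pos_pos)
    then show ?thesis
      using next_star_balanced[of "star_res m", OF star_res_pos path_le_p2] path_step_le[of m] Suc by auto
  qed simp
  then show "star_res n p3 + star_res n p1 \<le> 42 * star_res n p3"
    "star_res n p3 + star_res n p1 \<le> 42 * star_res n p1" by auto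
qed

text \<open>Although \<open>x\<close> grows by less than the factor 7, the quantity \<open>x - a x\<^sup>2 / r p2\<close> grows by at least this factor
  for suitable \<open>a\<close>. One step replaces \<open>x\<close> by at least \<open>7 x - x\<^sup>2 / (2 r p2)\<close> and \<open>x\<^sup>2 / r p2\<close> by at most
  \<open>98/17\<close> times itself, so the condition is \<open>1/2 + 98/17 a \<le> 7 a\<close>, with equality for \<open>a = 17/42\<close>. The
  initial value is positive, namely \<open>8/63\<close>.\<close>

lemma path_lower: "8/63 * 7 ^ n \<le> star_res n p3 + star_res n p1"
proof -
  define x where "x n = star_res n p3 + star_res n p1" for n
  define y where "y n = star_res n p2" for n
  have pos: "x n > 0" "y n > 0" for n by (simp_all add: x_def y_def star_res_pos add_pos_pos)
  have "8/63 * 7 ^ n \<le> x n - 17/42 * ((x n)\<^sup>2 / y n)"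
  proof (induction n)
    case 0
    then show ?case by (simp add: x_def y_def power2_eq_square)
  next
    case (Suc n)
    have "(x n)\<^sup>2 / (2 * (star_res n p1 + star_res n p2 + star_res n p3)) \<le> (x n)\<^sup>2 / (2 * y n)"
      using pos[of n] star_res_pos[of p1 n] star_res_pos[of p3 n]
      by (intro divide_left_mono mult_pos_pos) (auto simp: y_def add_pos_pos)
    then have 1: "7 * x n - (x n)\<^sup>2 / y n / 2 \<le> x (Suc n)"
      using next_star_path[of "star_res n", OF star_res_pos] by (simp add: x_def)
    have 2: "x (Suc n) \<le> 7 * x n" using path_step_le[of n] by (simp add: x_def)
    have 3: "17/2 * y n \<le> y (Suc n)"
      using next_star_p2_bounds(1)[of "star_res n", OF star_res_pos] by (simp add: y_def)
    have "(x (Suc n))\<^sup>2 / y (Suc n) \<le> (7 * x n)\<^sup>2 / (17/2 * y n)"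
      using 2 3 pos[of n] pos[of "Suc n"] by (intro frac_le power_mono) auto
    then have "(x (Suc n))\<^sup>2 / y (Suc n) \<le> 98/17 * ((x n)\<^sup>2 / y n)"
      by (simp add: power_mult_distrib)
    then show ?case using 1 Suc by simp
  qed
  also have "\<dots> \<le> x n" using pos[of n] by simp
  finally show ?thesis by (simp add: x_def)
qed

section \<open>The trace as a triangle\<close>

text \<open>The star-triangle transformation. The denominator is the arm at the third corner, provided that
  \<open>p\<close> and \<open>q\<close> are distinct corners.\<close>

definition triangle_res :: "(point \<Rightarrow> real) \<Rightarrow> point \<Rightarrow> point \<Rightarrow> real" where
  "triangle_res r p q = (r p1 * r p2 + r p2 * r p3 + r p3 * r p1) / (r p1 + r p2 + r p3 - r p - r q)"

lemma triangle_res_simps: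
  "triangle_res r p1 p2 = (r p1 * r p2 + r p2 * r p3 + r p3 * r p1) / r p3"
  "triangle_res r p2 p3 = (r p1 * r p2 + r p2 * r p3 + r p3 * r p1) / r p1"
  "triangle_res r p3 p1 = (r p1 * r p2 + r p2 * r p3 + r p3 * r p1) / r p2"
  by (simp_all add: triangle_res_def)

lemma triangle_res_sym: "triangle_res r p q = triangle_res r q p"
  by (simp add: triangle_res_def algebra_simps)

lemma pair_sum_V0_sym:
  assumes "\<forall>p\<in>V0. \<forall>q\<in>V0. p \<noteq> q \<longrightarrow> 0 < R p q \<and> R p q = R q p"
  shows "pair_sum V0 (\<lambda>p q. 1 / R p q * \<bar>u p - u q\<bar>\<^sup>2) =
    1 / R p1 p2 * (u p1 - u p2)\<^sup>2 + 1 / R p2 p3 * (u p2 - u p3)\<^sup>2 + 1 / R p3 p1 * (u p3 - u p1)\<^sup>2"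
  using assms by (subst pair_sum_V0) (simp_all add: power2_commute)

text \<open>The energy depends only on the values on \<open>V C n\<close>, so a potential may be cut off there.\<close>

lemma extensional_energies:
  assumes V0: "V0 \<subseteq> V C n" and u: "u \<in> V0 \<rightarrow>\<^sub>E UNIV"
  shows "{energy C n v | v. v \<in> V C n \<rightarrow>\<^sub>E UNIV \<and> restrict v V0 = u} =
    {energy C n v | v. \<forall>p\<in>V0. v p = u p}"
proof (intro equalityI subsetI)
  fix e assume "e \<in> {energy C n v | v. v \<in> V C n \<rightarrow>\<^sub>E UNIV \<and> restrict v V0 = u}"
  then show "e \<in> {energy C n v | v. \<forall>p\<in>V0. v p = u p}" by force
next
  fix e assume "e \<in> {energy C n v | v. \<forall>p\<in>V0. v p = u p}"
  then obtain v where v: "e = energy C n v" "\<forall>p\<in>V0. v p = u p" by blast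
  have "restrict (restrict v (V C n)) V0 = u"
    using V0 u v(2) by (auto simp: fun_eq_iff restrict_def PiE_def extensional_def)
  moreover have "e = energy C n (restrict v (V C n))"
    unfolding v(1) by (rule energy_cong) simp
  ultimately show "e \<in> {energy C n v | v. v \<in> V C n \<rightarrow>\<^sub>E UNIV \<and> restrict v V0 = u}" by auto
qed

lemma equivalent_star_trace:
  assumes r: "equivalent_star C n r" and V0: "V0 \<subseteq> V C n"
  shows "is_trace C n (triangle_res r)"
proof -
  have pos: "r p1 > 0" "r p2 > 0" "r p3 > 0" using r by (auto simp: equivalent_star_def)
  have "0 < triangle_res r p1 p2" "0 < triangle_res r p2 p3" "0 < triangle_res r p3 p1"
    unfolding triangle_res_simps using pos by (auto intro!: divide_pos_pos add_pos_pos)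
  then have R: "\<forall>p\<in>V0. \<forall>q\<in>V0. p \<noteq> q \<longrightarrow> 0 < triangle_res r p q \<and> triangle_res r p q = triangle_res r q p"
    using triangle_res_sym by (auto simp: V0_def)
  have "pair_sum V0 (\<lambda>p q. 1 / triangle_res r p q * \<bar>u p - u q\<bar>\<^sup>2) = star_energy r u" for u
    unfolding pair_sum_V0_sym[OF R]
    by (simp add: triangle_res_simps star_energy_def flip: add_divide_distrib)
  then show ?thesis
    using R r by (simp add: is_trace_def extensional_energies[OF V0] equivalent_star_def)
qed

text \<open>The indicator functions of the corners determine the sums of any two of the three conductances,
  hence the conductances.\<close>

lemma is_trace_unique:
  assumes R: "is_trace C n R" and S: "is_trace C n S" and pq: "p \<in> V0" "q \<in> V0" "p \<noteq> q"
  shows "R p q = S p q"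
proof -
  have Rsym: "\<forall>p\<in>V0. \<forall>q\<in>V0. p \<noteq> q \<longrightarrow> 0 < R p q \<and> R p q = R q p"
    and Ssym: "\<forall>p\<in>V0. \<forall>q\<in>V0. p \<noteq> q \<longrightarrow> 0 < S p q \<and> S p q = S q p"
    using R S by (simp_all add: is_trace_def)
  let ?form = "\<lambda>R u. pair_sum V0 (\<lambda>p q. 1 / R p q * \<bar>u p - u q\<bar>\<^sup>2)"
  have form_eq: "?form R u = ?form S u" if "u \<in> V0 \<rightarrow>\<^sub>E UNIV" for u
    using R S that unfolding is_trace_def is_minimum_def by (meson order_antisym)
  have eq: "?form R (restrict u V0) = ?form S (restrict u V0)" for u :: "point \<Rightarrow> real"
    by (rule form_eq) (simp only: restrict_PiE_iff UNIV_I simp_thms ball_triv)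
  note eq' = eq[unfolded pair_sum_V0_sym[OF Rsym] pair_sum_V0_sym[OF Ssym]]
  have "1 / R p1 p2 + 1 / R p3 p1 = 1 / S p1 p2 + 1 / S p3 p1"
    "1 / R p1 p2 + 1 / R p2 p3 = 1 / S p1 p2 + 1 / S p2 p3"
    "1 / R p2 p3 + 1 / R p3 p1 = 1 / S p2 p3 + 1 / S p3 p1"
    using eq'[of "corner_fun 1 0 0"] eq'[of "corner_fun 0 1 0"] eq'[of "corner_fun 0 0 1"] by simp_all
  then have "1 / R p1 p2 = 1 / S p1 p2" "1 / R p2 p3 = 1 / S p2 p3" "1 / R p3 p1 = 1 / S p3 p1"
    by argo+
  then have "R p1 p2 = S p1 p2" "R p2 p3 = S p2 p3" "R p3 p1 = S p3 p1" by simp_all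
  moreover from this have "R p2 p1 = S p2 p1" "R p3 p2 = S p3 p2" "R p1 p3 = S p1 p3"
    using Rsym Ssym V0_mem V0_distinct by metis+
  ultimately show ?thesis using pq unfolding V0_def by auto
qed

lemma trace_res_eq:
  assumes "is_trace C n R" "p \<in> V0" "q \<in> V0" "p \<noteq> q"
  shows "trace_res C n p q = R p q"
  unfolding trace_res_def using assms is_trace_unique by (intro the_equality) blast+

lemma is_trace_trace_res:
  assumes R: "is_trace C n R"
  shows "is_trace C n (trace_res C n)"
proof -
  have Rsym: "\<forall>p\<in>V0. \<forall>q\<in>V0. p \<noteq> q \<longrightarrow> 0 < R p q \<and> R p q = R q p"
    using R by (simp add: is_trace_def)
  have eq: "\<forall>p\<in>V0. \<forall>q\<in>V0. p \<noteq> q \<longrightarrow> trace_res C n p q = R p q"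
    using trace_res_eq[OF R] by blast
  then have Tsym: "\<forall>p\<in>V0. \<forall>q\<in>V0. p \<noteq> q \<longrightarrow> 0 < trace_res C n p q \<and> trace_res C n p q = trace_res C n q p"
    using Rsym by metis
  have "pair_sum V0 (\<lambda>p q. 1 / trace_res C n p q * \<bar>u p - u q\<bar>\<^sup>2) =
      pair_sum V0 (\<lambda>p q. 1 / R p q * \<bar>u p - u q\<bar>\<^sup>2)" for u
    unfolding pair_sum_V0_sym[OF Rsym] pair_sum_V0_sym[OF Tsym] using eq by simp
  then show ?thesis using R Tsym by (simp add: is_trace_def)
qed

text \<open>If the arm at \<open>p2\<close> is not small compared with the other two, then \<open>r p2 * (r p3 + r p1)\<close> is the main part of the
  numerator. Dividing it by the arm at \<open>p1\<close> or \<open>p3\<close>, comparable to \<open>r p3 + r p1\<close>, leaves \<open>r p2\<close>.\<close>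

lemma triangle_res_bounds:
  assumes r: "\<And>p. p \<in> V0 \<Longrightarrow> r p > 0" and x: "r p3 + r p1 \<le> 2 * r p2"
    and b: "r p3 + r p1 \<le> B * r p3" "r p3 + r p1 \<le> B * r p1"
  shows "r p2 \<le> triangle_res r p1 p2" "triangle_res r p1 p2 \<le> 3 * B * r p2"
    "r p2 \<le> triangle_res r p2 p3" "triangle_res r p2 p3 \<le> 3 * B * r p2"
    "r p3 + r p1 \<le> triangle_res r p3 p1" "triangle_res r p3 p1 \<le> 3 * (r p3 + r p1)"
proof -
  have pos: "r p1 > 0" "r p2 > 0" "r p3 > 0" by (simp_all add: r)
  let ?P = "r p1 * r p2 + r p2 * r p3 + r p3 * r p1"
  have "r p3 * r p1 \<le> (r p3 + r p1) * (r p3 + r p1)" using pos by (intro mult_mono) auto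
  also have "\<dots> \<le> 2 * r p2 * (r p3 + r p1)" using pos x by (intro mult_right_mono) auto
  finally have P: "?P \<le> 3 * r p2 * (r p3 + r p1)" by (simp add: algebra_simps)
  have P3: "?P \<le> 3 * B * r p2 * r p3"
    using P mult_left_mono[OF b(1), of "3 * r p2"] pos by (simp add: algebra_simps)
  have P1: "?P \<le> 3 * B * r p2 * r p1"
    using P mult_left_mono[OF b(2), of "3 * r p2"] pos by (simp add: algebra_simps)
  show "r p2 \<le> triangle_res r p1 p2" "r p2 \<le> triangle_res r p2 p3"
    "r p3 + r p1 \<le> triangle_res r p3 p1"
    unfolding triangle_res_simps using pos by (simp_all add: field_simps add_pos_pos)
  show "triangle_res r p1 p2 \<le> 3 * B * r p2" "triangle_res r p2 p3 \<le> 3 * B * r p2"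
    "triangle_res r p3 p1 \<le> 3 * (r p3 + r p1)"
    unfolding triangle_res_simps using pos P P1 P3 by (simp_all add: pos_divide_le_eq algebra_simps)
qed

section \<open>Comparability\<close>

lemma comparableI:
  assumes "a > 0" "\<And>n. g n \<ge> 0" "\<And>n. a * g n \<le> f n" "\<And>n. f n \<le> b * g n"
  shows "f \<asymp> g"
proof -
  define C where "C = max b (inverse a)"
  have C: "C > 0" "inverse C \<le> a" "b \<le> C"
    using \<open>a > 0\<close> by (auto simp: C_def less_max_iff_disj inverse_le_imp_le intro: le_imp_inverse_le[of "inverse a", simplified])
  have "inverse C * g n \<le> f n \<and> f n \<le> C * g n" for n
    using mult_right_mono[OF C(2) assms(2)[of n]] mult_right_mono[OF C(3) assms(2)[of n]]
      assms(3,4)[of n] by linarith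
  then show ?thesis using C(1) by (auto simp: comparable_def)
qed

lemma comparable_common:
  assumes "f \<asymp> h" "g \<asymp> h"
  shows "f \<asymp> g"
proof -
  obtain A where A: "A > 0" "\<And>n. inverse A * h n \<le> f n" "\<And>n. f n \<le> A * h n"
    using assms(1) by (auto simp: comparable_def)
  obtain B where B: "B > 0" "\<And>n. inverse B * h n \<le> g n" "\<And>n. g n \<le> B * h n"
    using assms(2) by (auto simp: comparable_def)
  have h: "h n \<le> A * f n" "h n \<le> B * g n" for n
    using A(1) A(2)[of n] B(1) B(2)[of n] by (simp_all add: field_simps)
  have "inverse (A * B) * g n \<le> f n \<and> f n \<le> (A * B) * g n" for n
  proof
    have "g n \<le> B * (A * f n)"
      using B(3)[of n] mult_left_mono[OF h(1)[of n], of B] B(1) by linarith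
    then show "inverse (A * B) * g n \<le> f n" using A(1) B(1) by (simp add: field_simps)
    have "A * h n \<le> A * (B * g n)" using h(2)[of n] A(1) by simp
    then show "f n \<le> (A * B) * g n" using A(3)[of n] by (simp add: mult.assoc)
  qed
  then show ?thesis
    using A(1) B(1) unfolding comparable_def by (intro exI[of _ "A * B"]) simp
qed

theorem proposition5p7:
  fixes c :: "nat \<Rightarrow> nat \<times> nat" and z :: "nat \<Rightarrow> point" and K :: "point set"
  assumes "right_chain c z"
    and "self_similar_set (sickle_cells c) K"
  shows "(\<forall>n. is_trace (sickle_cells c) n (trace_res (sickle_cells c) n)) \<and>
    (\<lambda>n. trace_res (sickle_cells c) n p1 p2) \<asymp> (\<lambda>n. trace_res (sickle_cells c) n p2 p3) \<and>
    (\<lambda>n. trace_res (sickle_cells c) n p2 p3) \<asymp> (\<lambda>n. (17/2) ^ n) \<and>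
    (\<lambda>n. trace_res (sickle_cells c) n p3 p1) \<asymp> (\<lambda>n. 7 ^ n)"
proof -
  interpret sickle c z by unfold_locales (rule assms(1))
  let ?C = "sickle_cells c"
  have trace: "is_trace ?C n (triangle_res (star_res n))" for n
    by (rule equivalent_star_trace[OF sickle_equivalent_star V0_subset_V[OF V0_in_sickle_corners]])
  have res: "trace_res ?C n p q = triangle_res (star_res n) p q" if "p \<in> V0" "q \<in> V0" "p \<noteq> q" for n p q
    by (rule trace_res_eq[OF trace that])
  have bounds: "star_res n p2 \<le> trace_res ?C n p1 p2" "trace_res ?C n p1 p2 \<le> 126 * star_res n p2"
    "star_res n p2 \<le> trace_res ?C n p2 p3" "trace_res ?C n p2 p3 \<le> 126 * star_res n p2"
    "star_res n p3 + star_res n p1 \<le> trace_res ?C n p3 p1"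
    "trace_res ?C n p3 p1 \<le> 3 * (star_res n p3 + star_res n p1)" for n
    using triangle_res_bounds[of "star_res n" 42, OF star_res_pos path_le_p2 star_res_balanced]
    by (simp_all add: res)
  \<comment> \<open>The constant is \<open>406 = 126 * 29/9\<close>.\<close>
  have R12: "(\<lambda>n. trace_res ?C n p1 p2) \<asymp> (\<lambda>n. (17/2) ^ n)"
  proof (rule comparableI[of "1/3" _ _ "406"])
    fix n
    show "1/3 * (17/2) ^ n \<le> trace_res ?C n p1 p2"
      using star_res_p2_lower[of n] bounds(1)[of n] by simp
    show "trace_res ?C n p1 p2 \<le> 406 * (17/2) ^ n"
      using star_res_p2_upper[of n] bounds(2)[of n] by simp
  qed simp_all
  have R23: "(\<lambda>n. trace_res ?C n p2 p3) \<asymp> (\<lambda>n. (17/2) ^ n)"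
  proof (rule comparableI[of "1/3" _ _ "406"])
    fix n
    show "1/3 * (17/2) ^ n \<le> trace_res ?C n p2 p3"
      using star_res_p2_lower[of n] bounds(3)[of n] by simp
    show "trace_res ?C n p2 p3 \<le> 406 * (17/2) ^ n"
      using star_res_p2_upper[of n] bounds(4)[of n] by simp
  qed simp_all
  have R31: "(\<lambda>n. trace_res ?C n p3 p1) \<asymp> (\<lambda>n. 7 ^ n)"
  proof (rule comparableI[of "8/63" _ _ "2"])
    fix n
    show "8/63 * 7 ^ n \<le> trace_res ?C n p3 p1"
      using path_lower[of n] bounds(5)[of n] by simp
    show "trace_res ?C n p3 p1 \<le> 2 * 7 ^ n"
      using path_upper[of n] bounds(6)[of n] by simp
  qed simp_all
  show ?thesis
    using is_trace_trace_res[OF trace] comparable_common[OF R12 R23] R23 R31 by blast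
qed

end
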